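(* Let $d\ge1$ and $\sigma\in(-d,0)$. There exists a constant $C^*(\sigma,d)>0$ such that, if $g\in C^0(\mathbb{R}^d)$ satisfies $g(x)\ge C_1+C_2|x|^{-\sigma}$ for all $x\in\mathbb{R}^d$, for some $C_1\in\mathbb{R}$ and $C_2>C^*(\sigma,d)$, then the following compactness property holds: let $M>0$ and let $\{\mu_\varepsilon\}_{\varepsilon\in(0,1)}\subset\mathcal{M}_b(\mathbb{R}^d)$ be such that $$\mathcal{T}^\sigma_\varepsilon(\mu_\varepsilon)\le M\qquad\text{for all }\varepsilon\in(0,1).$$ Then, up to a subsequence, $\frac{\varepsilon^d\omega_d}{C^d}\mu_\varepsilon\to\rho\,\mathcal{L}^d$ tightly in $\mathcal{M}_b(\mathbb{R}^d)$ for some $\rho\in L^1(\mathbb{R}^d,[0,1])$.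
   Context: $\mathcal{L}^d$ (also $|\cdot|$ on sets) is Lebesgue measure on $\mathbb{R}^d$, $\omega_d$ is the Lebesgue measure of the unit ball, $\mathcal{M}_b(\mathbb{R}^d)$ is the set of nonnegative finite Radon measures on $\mathbb{R}^d$, and $L^1(\mathbb{R}^d,[0,1])$ is the set of integrable functions with values in $[0,1]$. Optimal packing density: let $\mathrm{Ad}^d$ be the class of sets $X\subset\mathbb{R}^d$ with $|x-y|\ge2$ for all distinct $x,y\in X$, and let $Q=[0,1)^d$. Then $$C^d:=\sup_{X\in\mathrm{Ad}^d}\limsup_{r\to+\infty}\frac{\#(X\cap rQ)\,\omega_d}{|rQ|}.$$ Tight convergence $\nu_\varepsilon\to\nu$ in $\mathcal{M}_b(\mathbb{R}^d)$ means $\nu_\varepsilon\stackrel{*}{\rightharpoonup}\nu$ weakly-star and $\nu_\varepsilon(\mathbb{R}^d)\to\nu(\mathbb{R}^d)$ as $\varepsilon\to0^+$. "Up to a subsequence" means along some sequence $\varepsilon_n\to0^+$. For $\varepsilon>0$, $\mathcal{EM}_\varepsilon$ is the set of measures $\sum_{i=1}^N\delta_{x_i}$ ($N\in\mathbb{N}$, possibly $N=0$) with $|x_i-x_j|\ge2\varepsilon$ for all $i\ne j$. Discrete energies on $\mathcal{M}_b(\mathbb{R}^d)$: $$\mathcal{F}^\sigma_\varepsilon(\mu)=\sum_{i\ne j}-\frac{1}{|x_i-x_j|^{d+\sigma}}\Big(\frac{\omega_d\varepsilon^d}{C^d}\Big)^2\quad\text{if }\mu=\sum_{i=1}^N\delta_{x_i}\in\mathcal{EM}_\varepsilon,\qquad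 \mathcal{F}^\sigma_\varepsilon(\mu)=+\infty\text{ otherwise},$$ $$\mathcal{T}^\sigma_\varepsilon(\mu)=\mathcal{F}^\sigma_\varepsilon(\mu)+\int_{\mathbb{R}^d}g(x)\,\frac{\varepsilon^d\omega_d}{C^d}\,d\mu(x).$$ *)

theory Defs
  imports "HOL-Analysis.Analysis"
begin

text \<open>The ambient space is \<open>real ^ 'n\<close>, so that \<open>d = CARD('n)\<close>; constants depending
  only on \<open>d\<close> take a type argument.\<close>

definition unit_ball_measure :: "'n::finite itself \<Rightarrow> real" where
  "unit_ball_measure _ = measure lborel (ball (0 :: real ^ 'n) 1)"

definition packings :: "(real ^ 'n::finite) set set" where
  "packings = {X. \<forall>x\<in>X. \<forall>y\<in>X. x \<noteq> y \<longrightarrow> dist x y \<ge> 2}"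

definition unit_cube :: "(real ^ 'n::finite) set" where
  "unit_cube = {x. \<forall>i. 0 \<le> x $ i \<and> x $ i < 1}"

text \<open>The supremum is taken in the extended reals; it lies in \<open>(0, 1]\<close>, so the coercion to
  the reals loses nothing. Likewise the cardinality is that of a finite set, since a packing
  meets every bounded set in finitely many points.\<close>

definition packing_density :: "'n::finite itself \<Rightarrow> real" where
  "packing_density _ = real_of_ereal
     (SUP X\<in>(packings :: (real ^ 'n) set set).
        Limsup at_top (\<lambda>r::real.
          ereal (real (card (X \<inter> (\<lambda>x. r *\<^sub>R x) ` unit_cube)) * unit_ball_measure TYPE('n)
                 / measure lborel ((\<lambda>x. r *\<^sub>R x) ` (unit_cube :: (real ^ 'n) set)))))"

text \<open>Every finite Borel measure on a Euclidean space is a Radon measure.\<close>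

definition finite_radon_measures :: "(real ^ 'n::finite) measure set" where
  "finite_radon_measures = {\<mu>. sets \<mu> = sets borel \<and> finite_measure \<mu>}"

text \<open>Weak-star convergence is that of the dual of the continuous functions vanishing at
  infinity.\<close>

definition weak_star_convergent ::
    "('b \<Rightarrow> (real ^ 'n::finite) measure) \<Rightarrow> (real ^ 'n) measure \<Rightarrow> 'b filter \<Rightarrow> bool" where
  "weak_star_convergent \<nu>s \<nu> F \<longleftrightarrow>
     (\<forall>\<phi> :: real ^ 'n \<Rightarrow> real. continuous_on UNIV \<phi> \<and> (\<phi> \<longlongrightarrow> 0) at_infinity \<longrightarrow>
        ((\<lambda>k. integral\<^sup>L (\<nu>s k) \<phi>) \<longlongrightarrow> integral\<^sup>L \<nu> \<phi>) F)"

definition tightly_convergent ::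
    "('b \<Rightarrow> (real ^ 'n::finite) measure) \<Rightarrow> (real ^ 'n) measure \<Rightarrow> 'b filter \<Rightarrow> bool" where
  "tightly_convergent \<nu>s \<nu> F \<longleftrightarrow>
     weak_star_convergent \<nu>s \<nu> F \<and> ((\<lambda>k. measure (\<nu>s k) UNIV) \<longlongrightarrow> measure \<nu> UNIV) F"

text \<open>The measure \<open>\<Sum>i<N. \<delta>\<^sub>x\<^sub>i\<close>, as the image of the counting measure on the indices.\<close>

definition dirac_sum :: "nat \<Rightarrow> (nat \<Rightarrow> real ^ 'n::finite) \<Rightarrow> (real ^ 'n) measure" where
  "dirac_sum N x = distr (count_space {..<N}) borel x"

lemma emeasure_dirac_sum:
  assumes "A \<in> sets borel"
  shows "emeasure (dirac_sum N x) A = (\<Sum>i<N. indicator A (x i))"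
proof -
  have "x -` A \<inter> {..<N} = {i\<in>{..<N}. x i \<in> A}" by auto
  then have "emeasure (dirac_sum N x) A = of_nat (card {i\<in>{..<N}. x i \<in> A})"
    using assms unfolding dirac_sum_def
    by (subst emeasure_distr) (simp_all add: emeasure_count_space subset_eq)
  also have "\<dots> = (\<Sum>i<N. indicator A (x i))"
    by (simp add: indicator_def sum.If_cases Int_def)
  finally show ?thesis .
qed

definition hard_spheres :: "real \<Rightarrow> nat \<Rightarrow> (nat \<Rightarrow> real ^ 'n::finite) \<Rightarrow> bool" where
  "hard_spheres \<epsilon> N x \<longleftrightarrow> (\<forall>i<N. \<forall>j<N. i \<noteq> j \<longrightarrow> dist (x i) (x j) \<ge> 2 * \<epsilon>)"

definition empirical_measures :: "real \<Rightarrow> (real ^ 'n::finite) measure set" where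
  "empirical_measures \<epsilon> = {dirac_sum N x | N x. hard_spheres \<epsilon> N x}"

definition sphere_weight :: "'n::finite itself \<Rightarrow> real \<Rightarrow> real" where
  "sphere_weight _ \<epsilon> =
     \<epsilon> ^ CARD('n) * unit_ball_measure TYPE('n) / packing_density TYPE('n)"

definition pair_energy :: "real \<Rightarrow> real \<Rightarrow> nat \<Rightarrow> (nat \<Rightarrow> real ^ 'n::finite) \<Rightarrow> real" where
  "pair_energy \<sigma> \<epsilon> N x =
     (\<Sum>(i, j)\<in>{(i, j). i < N \<and> j < N \<and> i \<noteq> j}.
        - (1 / dist (x i) (x j) powr (real CARD('n) + \<sigma>)) * (sphere_weight TYPE('n) \<epsilon>)\<^sup>2)"

text \<open>For \<open>\<epsilon> > 0\<close> the energy does not depend on the enumeration of the atoms; see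
  \<open>riesz_energy_dirac_sum\<close> below.\<close>

definition riesz_energy :: "real \<Rightarrow> real \<Rightarrow> (real ^ 'n::finite) measure \<Rightarrow> ereal" where
  "riesz_energy \<sigma> \<epsilon> \<mu> =
     (if \<mu> \<in> empirical_measures \<epsilon>
      then ereal (THE e. \<exists>N x. hard_spheres \<epsilon> N x \<and> \<mu> = dirac_sum N x \<and> e = pair_energy \<sigma> \<epsilon> N x)
      else \<infinity>)"

text \<open>A continuous function is integrable against every empirical measure. Against other measures the
  Bochner integral may take its default value, but then the sum is \<open>\<infinity>\<close> anyway.\<close>

definition total_energy ::
    "real \<Rightarrow> (real ^ 'n::finite \<Rightarrow> real) \<Rightarrow> real \<Rightarrow> (real ^ 'n) measure \<Rightarrow> ereal" where
  "total_energy \<sigma> g \<epsilon> \<mu> =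
     riesz_energy \<sigma> \<epsilon> \<mu> + ereal (\<integral>x. g x * sphere_weight TYPE('n) \<epsilon> \<partial>\<mu>)"

lemma pair_energy_eq_sum_atoms:
  fixes x :: "nat \<Rightarrow> real ^ 'n::finite"
  assumes "\<epsilon> > 0" "hard_spheres \<epsilon> N x"
  defines "X \<equiv> {y. emeasure (dirac_sum N x) {y} \<noteq> 0}"
  shows "pair_energy \<sigma> \<epsilon> N x =
    (\<Sum>(y, z)\<in>{(y, z). y \<in> X \<and> z \<in> X \<and> y \<noteq> z}.
       - (1 / dist y z powr (real CARD('n) + \<sigma>)) * (sphere_weight TYPE('n) \<epsilon>)\<^sup>2)"
proof -
  have inj: "inj_on x {..<N}"
    using assms(1,2) unfolding hard_spheres_def inj_on_def by force
  have X: "X = x ` {..<N}"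
  proof -
    have "emeasure (dirac_sum N x) {y} = 0 \<longleftrightarrow> (\<forall>i<N. x i \<noteq> y)" for y
      by (subst emeasure_dirac_sum) (auto simp: indicator_def)
    then show ?thesis unfolding X_def by auto
  qed
  have "bij_betw (map_prod x x) {(i, j). i < N \<and> j < N \<and> i \<noteq> j}
          {(y, z). y \<in> X \<and> z \<in> X \<and> y \<noteq> z}"
    using inj unfolding X bij_betw_def inj_on_def by force
  then show ?thesis
    unfolding pair_energy_def
    by (subst sum.reindex_bij_betw[symmetric]) (auto intro: sum.cong)
qed

lemma riesz_energy_dirac_sum:
  assumes "\<epsilon> > 0" "hard_spheres \<epsilon> N x"
  shows "riesz_energy \<sigma> \<epsilon> (dirac_sum N x) = ereal (pair_energy \<sigma> \<epsilon> N x)"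
proof -
  have "(THE e. \<exists>N' x'. hard_spheres \<epsilon> N' x' \<and> dirac_sum N x = dirac_sum N' x' \<and>
           e = pair_energy \<sigma> \<epsilon> N' x') = pair_energy \<sigma> \<epsilon> N x"
  proof (rule the_equality)
    fix e
    assume "\<exists>N' x'. hard_spheres \<epsilon> N' x' \<and> dirac_sum N x = dirac_sum N' x' \<and>
              e = pair_energy \<sigma> \<epsilon> N' x'"
    then obtain N' x' where "hard_spheres \<epsilon> N' x'" "dirac_sum N x = dirac_sum N' x'"
      "e = pair_energy \<sigma> \<epsilon> N' x'" by blast
    then show "e = pair_energy \<sigma> \<epsilon> N x"
      using assms by (simp only: pair_energy_eq_sum_atoms)
  qed (use assms in blast)
  then show ?thesis
    using assms unfolding riesz_energy_def empirical_measures_def by auto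
qed

end

theory Submission
  imports Defs "HOL-Library.Diagonal_Subsequence"
begin

text \<open>
  Put \<open>p = d + \<sigma>\<close>, which lies in \<open>(0, d)\<close>, let \<open>q = d - p = -\<sigma>\<close>, and write \<open>w\<close> for the weight of
  one sphere, \<open>m\<close> for the total weighted mass of a configuration and \<open>h\<close> for its weighted moment of
  order \<open>q\<close>.

  \<^emph>\<open>Coercivity.\<close> Since the spheres are disjoint, a ball of radius \<open>R \<ge> \<epsilon>\<close> carries mass at most
  \<open>B R^d\<close>. Summing over dyadic shells, which gives a geometric series because \<open>p < d\<close>, the potential
  at an atom is at most \<open>A R^q + m R^(-p)\<close>, so the attraction is at most \<open>m (A R^q + m R^(-p))\<close>; and at
  least \<open>m - B R^d\<close> of the mass sits outside the ball, so \<open>h \<ge> R^q (m - B R^d)\<close>. Both bounds have the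
  same order in \<open>m\<close> when \<open>2 B R^d = m\<close>, and then the attraction is at most \<open>2 (A + 2 B) h\<close>, up to a
  constant accounting for small \<open>m\<close> (\<open>riesz_interaction_le_confinement\<close>). If the coefficient
  \<open>C2\<close> of the confining potential exceeds \<open>2 (A + 2 B)\<close>, a bound on the energy therefore bounds
  first \<open>m\<close> and then \<open>h\<close> (\<open>energy_a_priori_bounds\<close>); the bound on \<open>h\<close> is tightness.

  \<^emph>\<open>Density at most one.\<close> A separated configuration in a cube of side \<open>R\<close> extends periodically, with
  period \<open>R + 2\<close>, to a packing of the whole space. Its density cannot beat the optimal one, so the
  weighted empirical measure of a cube of side \<open>s\<close> is at most \<open>(s + 2 \<epsilon>)^d\<close>
  (\<open>sphere_mass_in_cube_le\<close>).

  \<^emph>\<open>Compactness.\<close> The finite unions of dyadic cubes form a countable ring. A diagonal subsequence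
  converges on each of its members, and the limit is an additive set function dominated by Lebesgue
  measure. Domination makes it continuous at the empty set, so it extends to a Borel measure; this
  measure still lies below Lebesgue measure, hence has a density with values in \<open>[0, 1]\<close>. Convergence
  on dyadic cubes together with tightness is tight convergence
  (\<open>tight_compactness_density_le_1\<close>).
\<close>

section \<open>Packings in cubes and the optimal density\<close>

lemma measurable_half_open_cube:
  "{x::real^'n::finite. \<forall>i. a $ i \<le> x $ i \<and> x $ i < a $ i + s} \<in> sets borel"
  by measurable

lemma emeasure_half_open_cube:
  fixes a :: "real ^ 'n::finite"
  assumes "0 \<le> s"
  shows "emeasure lborel {x. \<forall>i. a $ i \<le> x $ i \<and> x $ i < a $ i + s} = ennreal (s ^ CARD('n))"
    (is "emeasure lborel ?Q = _")
proof (rule antisym)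
  define b where "b = a + vec s"
  have prod: "(\<Prod>c\<in>Basis. (b - a) \<bullet> c) = s ^ CARD('n)"
  proof -
    have "(b - a) \<bullet> c = s" if "c \<in> Basis" for c :: "real ^ 'n"
      using that unfolding b_def Basis_vec_def by (auto simp: inner_axis)
    then have "(\<Prod>c\<in>(Basis :: (real ^ 'n) set). (b - a) \<bullet> c) = s ^ card (Basis :: (real ^ 'n) set)"
      by simp
    then show ?thesis by simp
  qed
  have le: "\<And>c. c \<in> Basis \<Longrightarrow> a \<bullet> c \<le> b \<bullet> c"
    using assms unfolding b_def Basis_vec_def by (auto simp: inner_axis)
  have sub: "box a b \<subseteq> ?Q" "?Q \<subseteq> cbox a b"
    by (auto simp: mem_box_cart b_def less_imp_le)
  have meas: "?Q \<in> sets lborel" using measurable_half_open_cube by simp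
  have "emeasure lborel (cbox a b) = ennreal (s ^ CARD('n))"
    using emeasure_lborel_cbox[OF le] prod by simp
  with emeasure_mono[OF sub(2), of lborel] show "emeasure lborel ?Q \<le> ennreal (s ^ CARD('n))" by simp
  have "emeasure lborel (box a b) = ennreal (s ^ CARD('n))"
    using emeasure_lborel_box[OF le] prod by simp
  with emeasure_mono[OF sub(1), of lborel] meas show "ennreal (s ^ CARD('n)) \<le> emeasure lborel ?Q" by simp
qed

lemma unit_ball_measure_pos: "unit_ball_measure TYPE('n::finite) > 0"
  unfolding unit_ball_measure_def by (subst content_ball) auto

lemma measure_ball_eq:
  "0 \<le> r \<Longrightarrow> measure lborel (ball (c :: real ^ 'n::finite) r) = unit_ball_measure TYPE('n) * r ^ CARD('n)"
  unfolding unit_ball_measure_def by (simp add: content_ball)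

text \<open>The balls of radius \<open>\<epsilon>\<close> around the points are disjoint and lie in the ball of radius \<open>R + \<epsilon>\<close>;
  compare volumes.\<close>

lemma card_separated_subset_ball:
  fixes X :: "(real ^ 'n::finite) set"
  assumes "X \<subseteq> ball c R" "\<epsilon> > 0" "R \<ge> 0" "finite X"
    and sep: "\<And>x y. x \<in> X \<Longrightarrow> y \<in> X \<Longrightarrow> x \<noteq> y \<Longrightarrow> 2 * \<epsilon> \<le> dist x y"
  shows "real (card X) \<le> (R / \<epsilon> + 1) ^ CARD('n)"
proof -
  let ?d = "CARD('n)"
  have disj: "disjoint_family_on (\<lambda>x. ball x \<epsilon>) X"
    unfolding disjoint_family_on_def
  proof (intro ballI impI)
    fix x y assume xy: "x \<in> X" "y \<in> X" "x \<noteq> y"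
    show "ball x \<epsilon> \<inter> ball y \<epsilon> = {}"
    proof (rule ccontr)
      assume "\<not> ?thesis"
      then obtain z where "dist x z < \<epsilon>" "dist y z < \<epsilon>" by auto
      then have "dist x y < 2 * \<epsilon>" using dist_triangle2[of x y z] by simp
      with sep[OF xy] show False by simp
    qed
  qed
  have "real (card X) * (unit_ball_measure TYPE('n) * \<epsilon> ^ ?d)
      = (\<Sum>x\<in>X. measure lborel (ball x \<epsilon>))"
    using assms by (simp add: measure_ball_eq)
  also have "\<dots> = measure lborel (\<Union>x\<in>X. ball x \<epsilon>)"
    using disj assms(4) by (intro measure_finite_Union[symmetric])
      (auto simp: emeasure_ball assms less_imp_le)
  also have "\<dots> \<le> measure lborel (ball c (R + \<epsilon>))"
  proof (rule measure_mono_fmeasurable)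
    show "(\<Union>x\<in>X. ball x \<epsilon>) \<subseteq> ball c (R + \<epsilon>)"
    proof clarify
      fix x y assume "x \<in> X" "y \<in> ball x \<epsilon>"
      then have "dist c x < R" "dist x y < \<epsilon>" using assms(1) by auto
      then show "y \<in> ball c (R + \<epsilon>)" using dist_triangle[of c y x] by simp
    qed
    show "(\<Union>x\<in>X. ball x \<epsilon>) \<in> sets lborel" using assms(4) by auto
  qed (rule fmeasurableI, auto simp: emeasure_ball assms less_imp_le)
  also have "\<dots> = unit_ball_measure TYPE('n) * (R + \<epsilon>) ^ ?d"
    using assms by (simp add: measure_ball_eq)
  finally have "real (card X) * \<epsilon> ^ ?d \<le> (R + \<epsilon>) ^ ?d"
    using unit_ball_measure_pos[where 'n='n] by (simp add: mult.left_commute)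
  moreover have "(R / \<epsilon> + 1) ^ ?d = (R + \<epsilon>) ^ ?d / \<epsilon> ^ ?d"
    using assms by (simp add: power_divide[symmetric] add_divide_distrib)
  ultimately show ?thesis using assms by (simp add: field_simps)
qed

lemma finite_packing_Int_ball:
  fixes X :: "(real ^ 'n::finite) set"
  assumes "X \<in> packings" "R \<ge> 0"
  shows "finite (X \<inter> ball c R)" and "real (card (X \<inter> ball c R)) \<le> (R + 1) ^ CARD('n)"
proof -
  have bd: "real (card Y) \<le> (R + 1) ^ CARD('n)" if "finite Y" "Y \<subseteq> X \<inter> ball c R" for Y
  proof -
    have "real (card Y) \<le> (R / 1 + 1) ^ CARD('n)"
      using that assms
      by (intro card_separated_subset_ball[where c=c and \<epsilon>=1]) (auto simp: packings_def)
    then show ?thesis by simp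
  qed
  show fin: "finite (X \<inter> ball c R)"
  proof (rule ccontr)
    assume "infinite (X \<inter> ball c R)"
    then obtain Y where "finite Y" "Y \<subseteq> X \<inter> ball c R"
      "card Y = Suc (nat \<lceil>(R + 1) ^ CARD('n)\<rceil>)"
      using infinite_arbitrarily_large[of "X \<inter> ball c R" "Suc (nat \<lceil>(R + 1) ^ CARD('n)\<rceil>)"] by auto
    then show False using bd[of Y] by linarith
  qed
  show "real (card (X \<inter> ball c R)) \<le> (R + 1) ^ CARD('n)" using bd[OF fin] by simp
qed

lemma scaled_unit_cube:
  assumes "r > 0"
  shows "(\<lambda>x. r *\<^sub>R x) ` (unit_cube :: (real ^ 'n::finite) set) = {x. \<forall>i. 0 \<le> x $ i \<and> x $ i < r}"
proof (intro set_eqI iffI)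
  fix x :: "real ^ 'n" assume "x \<in> {x. \<forall>i. 0 \<le> x $ i \<and> x $ i < r}"
  then have "x = r *\<^sub>R (x /\<^sub>R r)" "x /\<^sub>R r \<in> unit_cube"
    using assms by (auto simp: unit_cube_def field_simps)
  then show "x \<in> (\<lambda>x. r *\<^sub>R x) ` unit_cube" by blast
qed (use assms in \<open>auto simp: unit_cube_def\<close>)

lemma measure_scaled_unit_cube:
  assumes "r > 0"
  shows "measure lborel ((\<lambda>x. r *\<^sub>R x) ` (unit_cube :: (real ^ 'n::finite) set)) = r ^ CARD('n)"
  using emeasure_half_open_cube[of r "0 :: real ^ 'n"] assms
  by (simp add: scaled_unit_cube measure_def)

lemma scaled_unit_cube_subset_ball:
  assumes "r > 0"
  shows "(\<lambda>x. r *\<^sub>R x) ` (unit_cube :: (real ^ 'n::finite) set) \<subseteq> ball 0 (real CARD('n) * r + 1)"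
proof
  fix x :: "real ^ 'n" assume x: "x \<in> (\<lambda>x. r *\<^sub>R x) ` unit_cube"
  have "norm x \<le> (\<Sum>i\<in>UNIV. \<bar>x $ i\<bar>)" by (rule norm_le_l1_cart)
  also have "\<dots> \<le> (\<Sum>i\<in>(UNIV :: 'n set). r)"
    using x assms by (intro sum_mono) (auto simp: scaled_unit_cube less_imp_le)
  finally show "x \<in> ball 0 (real CARD('n) * r + 1)" by simp
qed

definition packing_ratio :: "(real ^ 'n::finite) set \<Rightarrow> real \<Rightarrow> real" where
  "packing_ratio X r = real (card (X \<inter> (\<lambda>x. r *\<^sub>R x) ` unit_cube)) * unit_ball_measure TYPE('n)
     / measure lborel ((\<lambda>x. r *\<^sub>R x) ` (unit_cube :: (real ^ 'n) set))"

text \<open>This crude uniform bound shows that the supremum defining the optimal density is finite, so that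
  it survives the passage from extended to real numbers.\<close>

lemma packing_ratio_le:
  fixes X :: "(real ^ 'n::finite) set"
  assumes "X \<in> packings" "r \<ge> 1"
  shows "packing_ratio X r \<le> unit_ball_measure TYPE('n) * real (CARD('n) + 2) ^ CARD('n)"
proof -
  let ?d = "CARD('n)" and ?Q = "(\<lambda>x. r *\<^sub>R x) ` (unit_cube :: (real ^ 'n) set)"
  have "card (X \<inter> ?Q) \<le> card (X \<inter> ball 0 (real ?d * r + 1))"
    using finite_packing_Int_ball(1)[OF assms(1), of "real ?d * r + 1" 0]
      scaled_unit_cube_subset_ball[where 'n='n, of r] assms
    by (intro card_mono) auto
  then have "real (card (X \<inter> ?Q)) \<le> (real ?d * r + 1 + 1) ^ ?d"
    using finite_packing_Int_ball(2)[OF assms(1), of "real ?d * r + 1" 0] assms by simp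
  also have "\<dots> \<le> (real (?d + 2) * r) ^ ?d"
    using assms by (intro power_mono) (auto simp: algebra_simps)
  also have "\<dots> = real (?d + 2) ^ ?d * r ^ ?d" by (rule power_mult_distrib)
  finally have "real (card (X \<inter> ?Q)) \<le> real (?d + 2) ^ ?d * r ^ ?d" .
  then have "real (card (X \<inter> ?Q)) * unit_ball_measure TYPE('n)
      \<le> real (?d + 2) ^ ?d * r ^ ?d * unit_ball_measure TYPE('n)"
    using unit_ball_measure_pos[where 'n='n] by (intro mult_right_mono) auto
  then show ?thesis
    using assms unfolding packing_ratio_def
    by (subst measure_scaled_unit_cube) (auto simp: field_simps)
qed

lemma packing_density_eq:
  "ereal (packing_density TYPE('n::finite)) =
     (SUP X\<in>(packings :: (real ^ 'n) set set). Limsup at_top (\<lambda>r. ereal (packing_ratio X r)))"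
proof -
  let ?S = "SUP X\<in>(packings :: (real ^ 'n) set set). Limsup at_top (\<lambda>r. ereal (packing_ratio X r))"
  have "?S \<le> ereal (unit_ball_measure TYPE('n) * real (CARD('n) + 2) ^ CARD('n))"
  proof (rule SUP_least)
    fix X :: "(real ^ 'n) set" assume X: "X \<in> packings"
    show "Limsup at_top (\<lambda>r. ereal (packing_ratio X r))
        \<le> ereal (unit_ball_measure TYPE('n) * real (CARD('n) + 2) ^ CARD('n))"
      by (rule Limsup_bounded, rule eventually_mono[OF eventually_ge_at_top[of 1]])
        (use packing_ratio_le[OF X] in auto)
  qed
  then have "?S < \<infinity>" by (rule le_less_trans) simp
  moreover have "0 \<le> ?S"
  proof (rule SUP_upper2)
    show "{} \<in> (packings :: (real ^ 'n) set set)" by (simp add: packings_def)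
    show "0 \<le> Limsup at_top (\<lambda>r. ereal (packing_ratio ({} :: (real ^ 'n) set) r))"
      by (simp add: packing_ratio_def Limsup_const zero_ereal_def)
  qed
  ultimately have "\<bar>?S\<bar> \<noteq> \<infinity>" by auto
  then show ?thesis
    unfolding packing_density_def packing_ratio_def[symmetric] by (simp add: ereal_real)
qed

text \<open>Repeat the configuration with period \<open>L = R + 2\<close> in every direction. The gap of width \<open>2\<close> between
  neighbouring copies keeps the points separated, so the result is a packing of density
  \<open>card X * \<omega> / L^d\<close>, which is at most the optimal density.\<close>

lemma card_packing_in_cube_le:
  fixes X :: "(real ^ 'n::finite) set"
  assumes X: "X \<in> packings" "finite X" and R: "R \<ge> 0"
    and sub: "\<And>x i. x \<in> X \<Longrightarrow> a $ i \<le> x $ i \<and> x $ i \<le> a $ i + R"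
  shows "real (card X) * unit_ball_measure TYPE('n)
    \<le> packing_density TYPE('n) * (R + 2) ^ CARD('n)"
proof -
  let ?d = "CARD('n)"
  define L where "L = R + 2"
  have L: "L > 0" using R by (simp add: L_def)
  define \<tau> :: "(real ^ 'n) \<times> ('n \<Rightarrow> int) \<Rightarrow> real ^ 'n"
    where "\<tau> = (\<lambda>(x, z). \<chi> i. x $ i - a $ i + L * of_int (z i))"
  define Y where "Y = \<tau> ` (X \<times> UNIV)"
  have far: "2 \<le> dist (\<tau> (x, z)) (\<tau> (x', z'))"
    if "x \<in> X" "x' \<in> X" "(x, z) \<noteq> (x', z')" for x x' z z'
  proof (cases "z = z'")
    case True
    then have "\<tau> (x, z) - \<tau> (x', z') = x - x'" by (simp add: \<tau>_def vec_eq_iff)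
    then have "dist (\<tau> (x, z)) (\<tau> (x', z')) = dist x x'" by (simp add: dist_norm)
    then show ?thesis using X that True by (auto simp: packings_def)
  next
    case False
    then obtain i where i: "z i \<noteq> z' i" by auto
    \<comment> \<open>Different copies: some coordinate is shifted by at least \<open>L\<close>, of which the two points inside
      the original cube can make up only \<open>R\<close>.\<close>
    have "1 \<le> \<bar>z i - z' i\<bar>" using i by simp
    then have "1 \<le> \<bar>real_of_int (z i) - of_int (z' i)\<bar>" by linarith
    then have "L \<le> \<bar>L * (real_of_int (z i) - of_int (z' i))\<bar>" using L by (simp add: abs_mult)
    moreover have "\<bar>x $ i - x' $ i\<bar> \<le> R" using sub[OF that(1), of i] sub[OF that(2), of i] by auto
    moreover have "(\<tau> (x, z) - \<tau> (x', z')) $ i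
        = (x $ i - x' $ i) + L * (real_of_int (z i) - of_int (z' i))"
      by (simp add: \<tau>_def algebra_simps)
    ultimately have "2 \<le> \<bar>(\<tau> (x, z) - \<tau> (x', z')) $ i\<bar>" unfolding L_def by linarith
    also have "\<dots> \<le> dist (\<tau> (x, z)) (\<tau> (x', z'))" unfolding dist_norm by (rule component_le_norm_cart)
    finally show ?thesis .
  qed
  have Y: "Y \<in> packings"
    unfolding packings_def Y_def
  proof (safe)
    fix x x' z z' assume h: "x \<in> X" "x' \<in> X" "\<tau> (x, z) \<noteq> \<tau> (x', z')"
    then have "(x, z) \<noteq> (x', z')" by auto
    with far h show "2 \<le> dist (\<tau> (x, z)) (\<tau> (x', z'))" by blast
  qed
  have inj: "inj_on \<tau> (X \<times> UNIV)"
  proof (rule inj_onI, rule ccontr)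
    fix p q assume "p \<in> X \<times> UNIV" "q \<in> X \<times> UNIV" and eq: "\<tau> p = \<tau> q" and "p \<noteq> q"
    then have "2 \<le> dist (\<tau> p) (\<tau> q)"
      using far[of "fst p" "fst q" "snd p" "snd q"] by (auto simp: mem_Times_iff)
    with eq show False by simp
  qed
  let ?c = "real (card X) * unit_ball_measure TYPE('n)"
  have lower: "?c * (1 / L - 1 / r) ^ ?d \<le> packing_ratio Y r" if r: "r \<ge> L" for r
  proof -
    have r0: "r > 0" using r L by simp
    let ?Q = "(\<lambda>x. r *\<^sub>R x) ` (unit_cube :: (real ^ 'n) set)"
    \<comment> \<open>\<open>K\<close> whole periods fit along each edge of the cube of side \<open>r\<close>.\<close>
    define K where "K = \<lfloor>r / L\<rfloor>"
    have K: "K \<ge> 1" "r / L - 1 \<le> of_int K" "of_int K * L \<le> r"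
    proof -
      have "1 \<le> r / L" using r L by simp
      then show "K \<ge> 1" unfolding K_def by linarith
      show "r / L - 1 \<le> of_int K" unfolding K_def by linarith
      have "of_int K \<le> r / L" unfolding K_def by simp
      then show "of_int K * L \<le> r" using L by (simp add: field_simps)
    qed
    define B where "B = X \<times> (Pi\<^sub>E UNIV (\<lambda>_. {0..<K}) :: ('n \<Rightarrow> int) set)"
    have fin: "finite (Y \<inter> ?Q)"
      using finite_packing_Int_ball(1)[OF Y, of "real ?d * r + 1" 0]
        scaled_unit_cube_subset_ball[where 'n='n, of r] r0
      by (intro finite_subset[of "Y \<inter> ?Q" "Y \<inter> ball 0 (real ?d * r + 1)"]) auto
    have "\<tau> ` B \<subseteq> Y \<inter> ?Q"
    proof clarify
      fix x z assume B: "(x, z) \<in> B"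
      then have x: "x \<in> X" and z: "\<And>i. 0 \<le> z i \<and> z i \<le> K - 1" by (auto simp: B_def PiE_iff)
      have "0 \<le> \<tau> (x, z) $ i \<and> \<tau> (x, z) $ i < r" for i
      proof -
        have "0 \<le> L * of_int (z i)" using L z by simp
        moreover have "L * of_int (z i) \<le> L * of_int (K - 1)"
          using L z[of i] by (intro mult_left_mono of_int_le_iff[THEN iffD2]) auto
        ultimately show ?thesis
          using sub[OF x, of i] K(3) L by (simp add: \<tau>_def algebra_simps L_def)
      qed
      then have "\<tau> (x, z) \<in> ?Q" using r0 by (simp add: scaled_unit_cube)
      then show "\<tau> (x, z) \<in> Y \<inter> ?Q" using x by (auto simp: Y_def)
    qed
    then have "card (\<tau> ` B) \<le> card (Y \<inter> ?Q)" by (rule card_mono[OF fin])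
    moreover have "card (\<tau> ` B) = card B"
      by (rule card_image, rule inj_on_subset[OF inj]) (auto simp: B_def)
    moreover have "card B = card X * nat K ^ ?d"
      by (simp add: B_def card_cartesian_product card_PiE)
    ultimately have "card X * nat K ^ ?d \<le> card (Y \<inter> ?Q)" by simp
    then have "real (card X * nat K ^ ?d) \<le> real (card (Y \<inter> ?Q))" by (rule of_nat_mono)
    then have "real (card X) * real_of_int K ^ ?d \<le> real (card (Y \<inter> ?Q))"
      using K(1) by simp
    moreover have "(r / L - 1) ^ ?d \<le> real_of_int K ^ ?d"
      using K r L by (intro power_mono) auto
    then have "real (card X) * (r / L - 1) ^ ?d \<le> real (card X) * real_of_int K ^ ?d"
      by (intro mult_left_mono) auto
    ultimately have *: "real (card X) * (r / L - 1) ^ ?d \<le> real (card (Y \<inter> ?Q))" by linarith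
    have "(1 / L - 1 / r) ^ ?d = (r / L - 1) ^ ?d / r ^ ?d"
    proof -
      have "1 / L - 1 / r = (r / L - 1) / r" using r0 by (simp add: diff_divide_distrib)
      then show ?thesis by (simp only: power_divide)
    qed
    then have "?c * (1 / L - 1 / r) ^ ?d
        = (real (card X) * (r / L - 1) ^ ?d) * unit_ball_measure TYPE('n) / r ^ ?d"
      by simp
    also have "\<dots> \<le> real (card (Y \<inter> ?Q)) * unit_ball_measure TYPE('n) / r ^ ?d"
      using unit_ball_measure_pos[where 'n='n] r0
      by (intro divide_right_mono mult_right_mono *) auto
    also have "\<dots> = packing_ratio Y r"
      unfolding packing_ratio_def measure_scaled_unit_cube[where 'n='n, OF r0] ..
    finally show ?thesis .
  qed
  have "((\<lambda>r. ?c * (1 / L - 1 / r) ^ ?d) \<longlongrightarrow> ?c * (1 / L - 0) ^ ?d) at_top"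
    by (intro tendsto_intros tendsto_divide_0[OF tendsto_const] filterlim_at_top_imp_at_infinity filterlim_ident)
  then have "ereal (?c * (1 / L) ^ ?d) = Limsup at_top (\<lambda>r. ereal (?c * (1 / L - 1 / r) ^ ?d))"
    by (intro lim_imp_Limsup[symmetric]) auto
  also have "Limsup at_top (\<lambda>r. ereal (?c * (1 / L - 1 / r) ^ ?d))
      \<le> Limsup at_top (\<lambda>r. ereal (packing_ratio Y r))"
    by (rule Limsup_mono, rule eventually_mono[OF eventually_ge_at_top[of L]]) (use lower in auto)
  also have "Limsup at_top (\<lambda>r. ereal (packing_ratio Y r)) \<le> ereal (packing_density TYPE('n))"
    unfolding packing_density_eq by (rule SUP_upper[OF Y])
  finally have "ereal (?c * (1 / L) ^ ?d) \<le> ereal (packing_density TYPE('n))" .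
  then have "?c / L ^ ?d \<le> packing_density TYPE('n)" by (simp add: power_divide)
  then show ?thesis using L by (simp add: L_def field_simps)
qed

text \<open>A single point already extends to a packing of positive density.\<close>

lemma packing_density_pos: "packing_density TYPE('n::finite) > 0"
proof -
  have "real (card {0 :: real ^ 'n}) * unit_ball_measure TYPE('n)
      \<le> packing_density TYPE('n) * (0 + 2) ^ CARD('n)"
    by (rule card_packing_in_cube_le[where a=0]) (auto simp: packings_def)
  then have "0 < packing_density TYPE('n) * 2 ^ CARD('n)"
    using unit_ball_measure_pos[where 'n='n] by simp
  then show ?thesis by (simp add: zero_less_mult_iff)
qed

section \<open>The ring of dyadic sets\<close>

definition dyadic_index :: "nat \<Rightarrow> real ^ 'n::finite \<Rightarrow> int ^ 'n" where
  "dyadic_index k x = (\<chi> i. \<lfloor>2 ^ k * x $ i\<rfloor>)"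

text \<open>Finite unions of dyadic cubes of one level, described through the index map: boolean operations on
  sets of the same level become boolean operations on finite sets of indices.\<close>

definition dyadic_sets :: "(real ^ 'n::finite) set set" where
  "dyadic_sets = {dyadic_index k -` Z | k Z. finite Z}"

lemma dyadic_setsI: "finite Z \<Longrightarrow> dyadic_index k -` Z \<in> dyadic_sets"
  unfolding dyadic_sets_def by blast

lemma dyadic_cube_eq:
  "dyadic_index k -` {z} = {x::real^'n::finite. \<forall>i. (\<chi> i. of_int (z $ i) / 2 ^ k) $ i \<le> x $ i \<and>
      x $ i < (\<chi> i. of_int (z $ i) / 2 ^ k) $ i + 1 / 2 ^ k}"
proof -
  have "\<lfloor>2 ^ k * y\<rfloor> = m \<longleftrightarrow> of_int m / 2 ^ k \<le> y \<and> y < of_int m / 2 ^ k + 1 / 2 ^ k" for m :: int and y :: real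
    by (simp add: floor_eq_iff field_simps)
  moreover have "x \<in> dyadic_index k -` {z} \<longleftrightarrow> (\<forall>i. \<lfloor>2 ^ k * x $ i\<rfloor> = z $ i)" for x :: "real ^ 'n"
    by (simp add: dyadic_index_def vec_eq_iff)
  ultimately show ?thesis by (intro set_eqI) simp
qed

lemma dyadic_vimage_measurable [measurable]: "dyadic_index k -` Z \<in> sets (borel :: (real ^ 'n::finite) measure)"
proof -
  have eq: "dyadic_index k -` Z = (\<Union>z\<in>Z. dyadic_index k -` {z} :: (real ^ 'n) set)" by auto
  show ?thesis
    unfolding eq using measurable_half_open_cube
    by (intro sets.countable_UN' countableI_type) (auto simp: dyadic_cube_eq)
qed

lemma dyadic_sets_borel: "dyadic_sets \<subseteq> sets borel"
  unfolding dyadic_sets_def by auto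

lemma emeasure_dyadic_cube:
  "emeasure lborel (dyadic_index k -` {z} :: (real ^ 'n::finite) set) = ennreal ((1 / 2 ^ k) ^ CARD('n))"
  unfolding dyadic_cube_eq by (rule emeasure_half_open_cube) simp

text \<open>Halving the indices of level \<open>k + 1\<close> gives those of level \<open>k\<close>, and an index is determined by its half
  and the parities of its entries; so finite index sets pull back to finite ones.\<close>

lemma dyadic_vimage_refine_Suc:
  assumes "finite Z"
  shows "\<exists>Z'. finite Z' \<and> (dyadic_index k -` Z :: (real ^ 'n::finite) set) = dyadic_index (Suc k) -` Z'"
proof -
  define half :: "int ^ 'n \<Rightarrow> int ^ 'n" where "half z = (\<chi> i. z $ i div 2)" for z
  define h where "h z = (half z, \<lambda>i. z $ i mod 2 = 1)" for z :: "int ^ 'n"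
  have "inj h"
  proof (rule injI)
    fix z w assume "h z = h w"
    then have "z $ i div 2 = w $ i div 2 \<and> (z $ i mod 2 = 1) = (w $ i mod 2 = 1)" for i
      by (auto simp: h_def half_def vec_eq_iff fun_eq_iff)
    then have "z $ i = w $ i" for i by (metis div_mult_mod_eq not_mod_2_eq_1_eq_0)
    then show "z = w" by (simp add: vec_eq_iff)
  qed
  then have "finite (h -` (Z \<times> UNIV))" using assms by (intro finite_vimageI) auto
  moreover have "h -` (Z \<times> UNIV) = half -` Z" by (auto simp: h_def)
  moreover have "half (dyadic_index (Suc k) x) = dyadic_index k x" for x :: "real ^ 'n"
  proof -
    have "\<lfloor>2 ^ k * x $ i\<rfloor> = \<lfloor>2 ^ Suc k * x $ i\<rfloor> div 2" for i
      using floor_divide_real_eq_div[of 2 "2 ^ Suc k * x $ i"] by simp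
    then show ?thesis by (simp add: half_def dyadic_index_def vec_eq_iff)
  qed
  then have "dyadic_index k -` Z = (dyadic_index (Suc k) -` (half -` Z) :: (real ^ 'n) set)"
    by auto
  ultimately show ?thesis by auto
qed

lemma dyadic_vimage_refine:
  assumes "k \<le> l" "finite Z"
  shows "\<exists>Z'. finite Z' \<and> (dyadic_index k -` Z :: (real ^ 'n::finite) set) = dyadic_index l -` Z'"
  using assms(1)
proof (induction l rule: dec_induct)
  case base show ?case using assms(2) by blast
next
  case (step l)
  then show ?case using dyadic_vimage_refine_Suc by metis
qed

lemma ring_of_sets_dyadic: "ring_of_sets UNIV (dyadic_sets :: (real ^ 'n::finite) set set)"
proof (rule ring_of_setsI)
  show "{} \<in> (dyadic_sets :: (real ^ 'n) set set)"
    using dyadic_setsI[of "{}" 0] by simp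
next
  fix A B :: "(real ^ 'n) set" assume "A \<in> dyadic_sets" "B \<in> dyadic_sets"
  then obtain k Z l W where A: "A = dyadic_index k -` Z" "finite Z"
    and B: "B = dyadic_index l -` W" "finite W"
    unfolding dyadic_sets_def by blast
  obtain Z' where Z': "finite Z'" "A = dyadic_index (max k l) -` Z'"
    using dyadic_vimage_refine[of k "max k l" Z] A by auto
  obtain W' where W': "finite W'" "B = dyadic_index (max k l) -` W'"
    using dyadic_vimage_refine[of l "max k l" W] B by auto
  show "A \<union> B \<in> dyadic_sets"
    unfolding Z' W' vimage_Un[symmetric] using Z' W' by (intro dyadic_setsI) auto
  show "A - B \<in> dyadic_sets"
    unfolding Z' W' vimage_Diff[symmetric] using Z' W' by (intro dyadic_setsI) auto
qed simp

lemma countable_dyadic_sets: "countable (dyadic_sets :: (real ^ 'n::finite) set set)"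
proof -
  have eq: "(dyadic_sets :: (real ^ 'n) set set)
      = (\<lambda>(k, Z). dyadic_index k -` Z) ` (UNIV \<times> Collect finite)"
    unfolding dyadic_sets_def by auto
  show ?thesis unfolding eq
    by (intro countable_image countable_SIGMA countable_Collect_finite countableI_type)
qed

lemma dist_same_dyadic_index:
  fixes x y :: "real ^ 'n::finite"
  assumes "dyadic_index k x = dyadic_index k y"
  shows "dist x y \<le> real CARD('n) / 2 ^ k"
proof -
  have "\<bar>(x - y) $ i\<bar> \<le> 1 / 2 ^ k" for i
  proof -
    have "\<lfloor>2 ^ k * x $ i\<rfloor> = \<lfloor>2 ^ k * y $ i\<rfloor>"
      using assms by (simp add: dyadic_index_def vec_eq_iff)
    then have "\<bar>2 ^ k * x $ i - 2 ^ k * y $ i\<bar> \<le> 1" by linarith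
    then have "2 ^ k * \<bar>x $ i - y $ i\<bar> \<le> 1"
      by (simp add: right_diff_distrib[symmetric] abs_mult)
    then show ?thesis by (simp add: field_simps)
  qed
  then have "(\<Sum>i\<in>UNIV. \<bar>(x - y) $ i\<bar>) \<le> (\<Sum>i\<in>(UNIV :: 'n set). 1 / 2 ^ k)"
    by (intro sum_mono)
  then show ?thesis
    unfolding dist_norm using norm_le_l1_cart[of "x - y"] by simp
qed

lemma dyadic_mesh_small:
  assumes "\<delta> > 0"
  obtains k where "real CARD('n::finite) / 2 ^ k < \<delta>"
proof -
  obtain k where "(1 / 2 :: real) ^ k < \<delta> / real CARD('n)"
    using real_arch_pow_inv[of "\<delta> / real CARD('n)" "1 / 2"] assms by auto
  then have "real CARD('n) / 2 ^ k < \<delta>" by (simp add: field_simps power_divide)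
  then show ?thesis by (rule that)
qed

lemma finite_dyadic_index_ball:
  "finite (dyadic_index k ` ball (0 :: real ^ 'n::finite) R)"
proof (rule finite_subset)
  define m where "m = \<lceil>2 ^ k * R\<rceil> + 1"
  have "finite (Pi\<^sub>E (UNIV :: 'n set) (\<lambda>_. {-m..m}))" by (intro finite_PiE) auto
  then show "finite (vec_lambda ` Pi\<^sub>E (UNIV :: 'n set) (\<lambda>_. {-m..m}))" by (rule finite_imageI)
  show "dyadic_index k ` ball (0 :: real ^ 'n) R \<subseteq> vec_lambda ` Pi\<^sub>E (UNIV :: 'n set) (\<lambda>_. {-m..m})"
  proof clarify
    fix x :: "real ^ 'n" assume x: "x \<in> ball 0 R"
    have "\<lfloor>2 ^ k * x $ i\<rfloor> \<in> {-m..m}" for i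
    proof -
      have "\<bar>x $ i\<bar> \<le> R" using component_le_norm_cart[of x i] x by simp
      then have "\<bar>2 ^ k * x $ i\<bar> \<le> 2 ^ k * R" by (simp add: abs_mult)
      then show ?thesis unfolding m_def atLeastAtMost_iff by linarith
    qed
    then show "dyadic_index k x \<in> vec_lambda ` Pi\<^sub>E (UNIV :: 'n set) (\<lambda>_. {-m..m})"
      unfolding dyadic_index_def by (intro imageI) auto
  qed
qed

lemma ball_subset_dyadic_set:
  obtains A where "A \<in> dyadic_sets" "ball (0 :: real ^ 'n::finite) R \<subseteq> A"
  using dyadic_setsI[OF finite_dyadic_index_ball[of 0 R]] by (metis subset_vimage_iff order_refl image_subset_iff_subset_vimage)

text \<open>There are countably many dyadic sets, and around each point of \<open>U\<close> a fine enough dyadic cube fits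
  into \<open>U\<close>; take the finite unions of an enumeration of the dyadic subsets of \<open>U\<close>.\<close>

lemma open_eq_incseq_dyadic_sets:
  fixes U :: "(real ^ 'n::finite) set"
  assumes "open U"
  obtains A :: "nat \<Rightarrow> (real ^ 'n) set" where "range A \<subseteq> dyadic_sets" "incseq A" "(\<Union>j. A j) = U"
proof -
  interpret ring_of_sets UNIV "dyadic_sets :: (real ^ 'n) set set" by (rule ring_of_sets_dyadic)
  define D where "D = {A \<in> dyadic_sets. A \<subseteq> U}"
  have D: "countable D" "D \<noteq> {}"
    using countable_dyadic_sets unfolding D_def
    by (auto intro: countable_subset[of _ dyadic_sets])
  define A where "A j = (\<Union>i\<le>j. from_nat_into D i)" for j :: nat
  have inD: "from_nat_into D i \<in> D" for i using D by (intro from_nat_into)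
  show ?thesis
  proof
    show "range A \<subseteq> dyadic_sets"
      unfolding A_def using inD by (auto simp: D_def intro!: finite_UN)
    show "incseq A" unfolding A_def by (rule incseq_SucI) (auto simp: atMost_Suc)
    have "(\<Union>j. A j) = (\<Union>i. from_nat_into D i)" by (auto simp: A_def)
    also have "\<dots> = \<Union>D" using range_from_nat_into[OF D(2,1)] by simp
    also have "\<dots> = U"
    proof
      show "\<Union>D \<subseteq> U" by (auto simp: D_def)
      show "U \<subseteq> \<Union>D"
      proof
        fix x assume "x \<in> U"
        then obtain \<delta> where \<delta>: "\<delta> > 0" "ball x \<delta> \<subseteq> U" using assms openE by blast
        obtain k where k: "real CARD('n) / 2 ^ k < \<delta>" using dyadic_mesh_small[OF \<delta>(1)] .
        have "dyadic_index k -` {dyadic_index k x} \<subseteq> ball x \<delta>"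
        proof
          fix y assume "y \<in> dyadic_index k -` {dyadic_index k x}"
          then have "dist x y \<le> real CARD('n) / 2 ^ k" by (intro dist_same_dyadic_index) simp
          with k show "y \<in> ball x \<delta>" by simp
        qed
        then have "dyadic_index k -` {dyadic_index k x} \<in> D"
          using \<delta> by (auto simp: D_def intro: dyadic_setsI)
        then show "x \<in> \<Union>D" by blast
      qed
    qed
    finally show "(\<Union>j. A j) = U" .
  qed
qed

lemma sigma_sets_dyadic: "sigma_sets UNIV (dyadic_sets :: (real ^ 'n::finite) set set) = sets borel"
proof
  show "sigma_sets UNIV (dyadic_sets :: (real ^ 'n) set set) \<subseteq> sets borel"
    using sets.sigma_sets_subset[OF dyadic_sets_borel] by simp
  have "{S. open S} \<subseteq> sigma_sets UNIV (dyadic_sets :: (real ^ 'n) set set)"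
  proof clarify
    fix S :: "(real ^ 'n) set" assume "open S"
    then obtain A :: "nat \<Rightarrow> (real ^ 'n) set" where A: "range A \<subseteq> dyadic_sets" "(\<Union>j. A j) = S"
      by (rule open_eq_incseq_dyadic_sets)
    then have "(\<Union>j. A j) \<in> sigma_sets UNIV dyadic_sets"
      by (intro sigma_sets.Union sigma_sets.Basic) auto
    then show "S \<in> sigma_sets UNIV dyadic_sets" using A by simp
  qed
  then have "sigma_sets UNIV {S. open S} \<subseteq> sigma_sets UNIV (dyadic_sets :: (real ^ 'n) set set)"
    by (rule sigma_sets_mono)
  then show "sets borel \<subseteq> sigma_sets UNIV (dyadic_sets :: (real ^ 'n) set set)"
    by (simp add: borel_def)
qed

text \<open>Caratheodory extension needs continuity at the empty set. It is inherited from Lebesgue measure,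
  which dominates \<open>L\<close> and is finite on dyadic sets.\<close>

lemma dominated_dyadic_content_extends:
  fixes L :: "(real ^ 'n::finite) set \<Rightarrow> real"
  assumes nonneg: "\<And>A. A \<in> dyadic_sets \<Longrightarrow> 0 \<le> L A"
    and add: "\<And>A B. A \<in> dyadic_sets \<Longrightarrow> B \<in> dyadic_sets \<Longrightarrow> A \<inter> B = {} \<Longrightarrow> L (A \<union> B) = L A + L B"
    and dom: "\<And>A. A \<in> dyadic_sets \<Longrightarrow> ennreal (L A) \<le> emeasure lborel A"
  obtains \<nu> where "sets \<nu> = sets borel" "\<And>A. A \<in> dyadic_sets \<Longrightarrow> emeasure \<nu> A = ennreal (L A)"
proof -
  interpret ring_of_sets UNIV "dyadic_sets :: (real ^ 'n) set set" by (rule ring_of_sets_dyadic)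
  have fin: "emeasure lborel A \<noteq> \<infinity>" if A: "A \<in> dyadic_sets" for A :: "(real ^ 'n) set"
  proof -
    obtain k Z where A: "A = dyadic_index k -` Z" "finite Z"
      using A by (auto simp: dyadic_sets_def)
    have "A = (\<Union>z\<in>Z. dyadic_index k -` {z})" using A by auto
    then have "emeasure lborel A \<le> (\<Sum>z\<in>Z. emeasure lborel (dyadic_index k -` {z} :: (real ^ 'n) set))"
      using A by (auto intro!: emeasure_subadditive_finite)
    also have "\<dots> < \<infinity>" using A by (simp add: emeasure_dyadic_cube sum_ennreal ennreal_of_nat_eq_real_of_nat ennreal_mult_less_top)
    finally show ?thesis by simp
  qed
  have "\<exists>\<mu> :: (real ^ 'n) set \<Rightarrow> ennreal. (\<forall>s\<in>dyadic_sets. \<mu> s = ennreal (L s)) \<and>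
      measure_space UNIV (sigma_sets UNIV dyadic_sets) \<mu>"
  proof (rule caratheodory_empty_continuous)
    have "L {} = 0" using add[of "{}" "{}"] by simp
    then show "positive dyadic_sets (\<lambda>s. ennreal (L s))" by (simp add: positive_def)
    show "additive dyadic_sets (\<lambda>s. ennreal (L s))"
      unfolding additive_def using add nonneg by (auto simp: ennreal_plus[symmetric] simp del: ennreal_plus)
    fix A :: "nat \<Rightarrow> (real ^ 'n) set"
    assume A: "range A \<subseteq> dyadic_sets" "decseq A" "(\<Inter>i. A i) = {}"
    have "(\<lambda>i. emeasure lborel (A i)) \<longlonglongrightarrow> emeasure lborel (\<Inter>i. A i)"
      using A fin dyadic_sets_borel by (intro Lim_emeasure_decseq) auto
    then have lim: "(\<lambda>i. emeasure lborel (A i)) \<longlonglongrightarrow> 0" using A by simp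
    show "(\<lambda>i. ennreal (L (A i))) \<longlonglongrightarrow> 0"
    proof (rule tendsto_sandwich[OF _ _ tendsto_const lim])
      show "\<forall>\<^sub>F i in sequentially. ennreal (L (A i)) \<le> emeasure lborel (A i)"
        using A dom by (intro always_eventually allI) blast
    qed simp
  qed simp
  then obtain \<mu> :: "(real ^ 'n) set \<Rightarrow> ennreal"
    where \<mu>: "\<And>s. s \<in> dyadic_sets \<Longrightarrow> \<mu> s = ennreal (L s)" "measure_space UNIV (sets borel) \<mu>"
    unfolding sigma_sets_dyadic by blast
  define \<nu> where "\<nu> = measure_of UNIV (sets borel) \<mu>"
  show ?thesis
  proof
    show sets: "sets \<nu> = sets borel"
      unfolding \<nu>_def using sets.sigma_sets_eq[of borel] by (subst sets_measure_of) auto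
    fix A :: "(real ^ 'n) set" assume A: "A \<in> dyadic_sets"
    have "emeasure \<nu> A = \<mu> A"
      unfolding \<nu>_def
      using \<mu>(2) A dyadic_sets_borel
      by (intro emeasure_measure_of_sigma) (auto simp: measure_space_def)
    then show "emeasure \<nu> A = ennreal (L A)" using \<mu>(1)[OF A] by simp
  qed
qed

text \<open>Exhausting by dyadic sets gives the inequality for open sets; outer regularity of Lebesgue measure
  carries it to Borel sets.\<close>

lemma emeasure_le_lborel_if_le_on_dyadic:
  fixes \<nu> :: "(real ^ 'n::finite) measure"
  assumes sets: "sets \<nu> = sets borel"
    and le: "\<And>A. A \<in> dyadic_sets \<Longrightarrow> emeasure \<nu> A \<le> emeasure lborel A"
    and B: "B \<in> sets borel"
  shows "emeasure \<nu> B \<le> emeasure lborel B"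
proof (rule ennreal_le_epsilon)
  have op: "emeasure \<nu> U \<le> emeasure lborel U" if U: "open U" for U
  proof -
    obtain A :: "nat \<Rightarrow> (real ^ 'n) set" where A: "range A \<subseteq> dyadic_sets" "incseq A" "(\<Union>j. A j) = U"
      using open_eq_incseq_dyadic_sets[OF U] .
    have "(\<lambda>j. emeasure \<nu> (A j)) \<longlonglongrightarrow> emeasure \<nu> (\<Union>j. A j)"
      using A sets dyadic_sets_borel by (intro Lim_emeasure_incseq) auto
    moreover have "(\<lambda>j. emeasure lborel (A j)) \<longlonglongrightarrow> emeasure lborel (\<Union>j. A j)"
      using A dyadic_sets_borel by (intro Lim_emeasure_incseq) auto
    ultimately show ?thesis
      unfolding A(3) by (rule LIMSEQ_le) (use le A(1) in \<open>intro exI allI impI, auto\<close>)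
  qed
  fix e :: real assume e: "e > 0"
  obtain U where U: "open U" "B \<subseteq> U" "emeasure lborel (U - B) < e"
    using outer_regular_lborel[OF B e] .
  have "emeasure \<nu> B \<le> emeasure \<nu> U" using U sets by (intro emeasure_mono) auto
  also have "\<dots> \<le> emeasure lborel U" by (rule op[OF U(1)])
  also have "\<dots> \<le> emeasure lborel B + emeasure lborel (U - B)"
  proof -
    have "emeasure lborel (B \<union> (U - B)) \<le> emeasure lborel B + emeasure lborel (U - B)"
      using U B by (intro emeasure_subadditive) auto
    moreover have "B \<union> (U - B) = U" using U by auto
    ultimately show ?thesis by simp
  qed
  also have "\<dots> \<le> emeasure lborel B + ennreal e" using U by (intro add_left_mono) auto
  finally show "emeasure \<nu> B \<le> emeasure lborel B + ennreal e" .
qed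

text \<open>If the Radon-Nikodym density \<open>f\<close> exceeds \<open>1\<close> on \<open>B\<close>, then \<open>\<integral>\<^sub>B (f - 1) = \<nu> B - |B| \<le> 0\<close> forces \<open>B\<close> to be
  null, so \<open>f\<close> may be cut off at \<open>1\<close>.\<close>

lemma dominated_measure_has_density_le_1:
  fixes \<nu> :: "'a::euclidean_space measure"
  assumes sets: "sets \<nu> = sets borel" and fin: "finite_measure \<nu>"
    and le: "\<And>B. B \<in> sets borel \<Longrightarrow> emeasure \<nu> B \<le> emeasure lborel B"
  obtains \<rho> :: "'a \<Rightarrow> real" where "integrable lborel \<rho>" "\<And>x. \<rho> x \<in> {0..1}"
    "\<nu> = density lborel (\<lambda>x. ennreal (\<rho> x))"
proof -
  have sets': "sets \<nu> = sets lborel" using sets by simp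
  have "absolutely_continuous lborel \<nu>"
    unfolding absolutely_continuous_def
  proof
    fix N :: "'a set" assume "N \<in> null_sets lborel"
    then show "N \<in> null_sets \<nu>" using le[of N] sets by (auto simp: null_sets_def)
  qed
  from sigma_finite_measure.Radon_Nikodym[OF sigma_finite_lborel this sets'] obtain f :: "'a \<Rightarrow> ennreal"
    where f[measurable]: "f \<in> borel_measurable lborel" and \<nu>: "density lborel f = \<nu>" by blast
  define B where "B = {x. 1 < f x}"
  have B[measurable]: "B \<in> sets borel" unfolding B_def by measurable
  let ?F = "\<lambda>x. f x * indicator B x" and ?G = "\<lambda>x. indicator B x :: ennreal"
  have GF: "?G x \<le> ?F x" for x by (auto simp: indicator_def B_def less_imp_le)
  have F: "(\<integral>\<^sup>+x. ?F x \<partial>lborel) = emeasure \<nu> B"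
    unfolding \<nu>[symmetric] by (subst emeasure_density) auto
  have G: "(\<integral>\<^sup>+x. ?G x \<partial>lborel) = emeasure lborel B" by simp
  have finB: "emeasure \<nu> B < \<infinity>" using finite_measure.emeasure_finite[OF fin] by (simp add: less_top)
  have "(\<integral>\<^sup>+x. ?G x \<partial>lborel) \<le> (\<integral>\<^sup>+x. ?F x \<partial>lborel)" by (intro nn_integral_mono GF)
  then have fin2: "(\<integral>\<^sup>+x. ?G x \<partial>lborel) \<noteq> \<infinity>" using finB F by (auto simp: top_unique)
  have "(\<integral>\<^sup>+x. ?F x - ?G x \<partial>lborel) = (\<integral>\<^sup>+x. ?F x \<partial>lborel) - (\<integral>\<^sup>+x. ?G x \<partial>lborel)"
    using fin2 GF by (intro nn_integral_diff) auto
  also have "\<dots> = 0" unfolding F G using le[OF B] finB by (simp add: diff_eq_0_iff_ennreal)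
  finally have "AE x in lborel. ?F x - ?G x = 0" by (subst (asm) nn_integral_0_iff_AE) auto
  then have AE: "AE x in lborel. f x \<le> 1"
  proof (rule AE_mp, intro AE_I2 impI)
    fix x assume h: "?F x - ?G x = 0"
    show "f x \<le> 1"
    proof (rule ccontr)
      assume "\<not> f x \<le> 1"
      then have "x \<in> B" by (simp add: B_def)
      with h have "f x - 1 = 0" by simp
      then have "f x \<le> 1" by (rule ennreal_minus_eq_0)
      with \<open>\<not> f x \<le> 1\<close> show False by simp
    qed
  qed
  define \<rho> where "\<rho> x = enn2real (min 1 (f x))" for x
  have \<rho>: "ennreal (\<rho> x) = min 1 (f x)" for x
    unfolding \<rho>_def by (rule ennreal_enn2real) (simp add: min_less_iff_disj)
  have \<rho>_range: "\<rho> x \<in> {0..1}" for x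
  proof -
    have "ennreal (\<rho> x) \<le> 1" unfolding \<rho> by simp
    then show ?thesis by (auto simp: \<rho>_def ennreal_le_1)
  qed
  have [measurable]: "\<rho> \<in> borel_measurable lborel" unfolding \<rho>_def by measurable
  have eq: "\<nu> = density lborel (\<lambda>x. ennreal (\<rho> x))"
    unfolding \<nu>[symmetric] using AE by (intro density_cong) (auto simp: \<rho> min_def)
  have "(\<integral>\<^sup>+x. ennreal (\<rho> x) \<partial>lborel) = emeasure \<nu> (space \<nu>)"
    unfolding eq by (subst emeasure_density) auto
  also have "\<dots> < \<infinity>" using finite_measure.emeasure_finite[OF fin] by (simp add: less_top)
  finally have "integrable lborel \<rho>"
    using \<rho>_range by (intro integrableI_nonneg) auto
  then show ?thesis using \<rho>_range eq by (rule that)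
qed

section \<open>Compactness of measures with asymptotic density at most one\<close>

lemma diagonal_convergent_subseq:
  fixes f :: "nat \<Rightarrow> nat \<Rightarrow> real"
  assumes bound: "\<And>i n. \<bar>f i n\<bar> \<le> K"
  obtains r :: "nat \<Rightarrow> nat" where "strict_mono r" "\<And>i. convergent (\<lambda>n. f i (r n))"
proof -
  interpret subseqs "\<lambda>i s. convergent (\<lambda>n. f i (s n))"
  proof
    fix i and s :: "nat \<Rightarrow> nat" assume "strict_mono s"
    have "bounded (range (\<lambda>n. f i (s n)))"
      using bound by (auto intro!: boundedI)
    then obtain l r where "strict_mono r" "((\<lambda>n. f i (s n)) \<circ> r) \<longlonglongrightarrow> l"
      using bounded_imp_convergent_subsequence by blast
    then show "\<exists>r'. strict_mono r' \<and> convergent (\<lambda>n. f i ((s \<circ> r') n))"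
      by (auto simp: convergent_def o_def)
  qed
  have "convergent (\<lambda>n. f i (diagseq n))" for i
  proof -
    have "convergent (\<lambda>n. f i ((diagseq \<circ> (+) (Suc i)) n))"
    proof (rule diagseq_holds)
      fix r s :: "nat \<Rightarrow> nat" and n
      assume "strict_mono r" "convergent (\<lambda>k. f n (s k))"
      then show "convergent (\<lambda>k. f n ((s \<circ> r) k))"
        using convergent_subseq_convergent[of "\<lambda>k. f n (s k)" r] by (simp add: o_def)
    qed
    then have "convergent (\<lambda>n. f i (diagseq (n + Suc i)))" by (simp add: o_def add.commute)
    then show ?thesis using convergent_ignore_initial_segment[of "\<lambda>n. f i (diagseq n)" "Suc i"] by simp
  qed
  with subseq_diagseq show ?thesis by (rule that)
qed

text \<open>Outside a large ball \<open>\<phi>\<close> is small and the step function vanishes; on a slightly larger compact ball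
  \<open>\<phi>\<close> is uniformly continuous. The approximation is uniform on the whole space, which lets the masses of the
  measures alone control the error of the integrals.\<close>

lemma dyadic_step_approx:
  fixes \<phi> :: "real ^ 'n::finite \<Rightarrow> real"
  assumes cont: "continuous_on UNIV \<phi>" and lim: "(\<phi> \<longlongrightarrow> 0) at_infinity" and "\<eta> > 0"
  obtains k c Z where "finite Z"
    "\<And>x. \<bar>\<phi> x - (\<Sum>z\<in>Z. c z * indicator (dyadic_index k -` {z}) x)\<bar> \<le> \<eta>"
proof -
  let ?d = "real CARD('n)"
  have "\<forall>\<^sub>F x in at_infinity. dist (\<phi> x) 0 < \<eta>" using lim \<open>\<eta> > 0\<close> by (rule tendstoD)
  then obtain R where R: "\<And>x. R \<le> norm x \<Longrightarrow> \<bar>\<phi> x\<bar> < \<eta>"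
    by (auto simp: eventually_at_infinity)
  have "uniformly_continuous_on (cball 0 (R + ?d)) \<phi>"
    using cont by (intro compact_uniformly_continuous) (auto intro: continuous_on_subset)
  then obtain \<delta> where \<delta>: "\<delta> > 0"
    "\<And>x y. x \<in> cball 0 (R + ?d) \<Longrightarrow> y \<in> cball 0 (R + ?d) \<Longrightarrow> dist y x < \<delta> \<Longrightarrow> dist (\<phi> y) (\<phi> x) < \<eta>"
    unfolding uniformly_continuous_on_def using \<open>\<eta> > 0\<close> by metis
  obtain k where k: "?d / 2 ^ k < \<delta>" using dyadic_mesh_small[OF \<delta>(1)] .
  have kd: "?d / 2 ^ k \<le> ?d" by (simp add: field_simps)
  define Z where "Z = dyadic_index k ` ball (0 :: real ^ 'n) R"
  have Z: "finite Z" unfolding Z_def by (rule finite_dyadic_index_ball)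
  \<comment> \<open>On each cube meeting the ball of radius \<open>R\<close>, take the value at some point of the cube in that
    ball.\<close>
  define c where "c z = \<phi> (inv_into (ball 0 R) (dyadic_index k) z)" for z
  show ?thesis
  proof (rule that[OF Z])
    fix x :: "real ^ 'n"
    have "(\<Sum>z\<in>Z. c z * indicator (dyadic_index k -` {z}) x)
        = (\<Sum>z\<in>Z. if z = dyadic_index k x then c z else 0)"
      by (intro sum.cong) (auto simp: indicator_def)
    also have "\<dots> = (if dyadic_index k x \<in> Z then c (dyadic_index k x) else 0)"
      using Z by simp
    finally have s: "(\<Sum>z\<in>Z. c z * indicator (dyadic_index k -` {z}) x)
        = (if dyadic_index k x \<in> Z then c (dyadic_index k x) else 0)" .
    show "\<bar>\<phi> x - (\<Sum>z\<in>Z. c z * indicator (dyadic_index k -` {z}) x)\<bar> \<le> \<eta>"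
    proof (cases "dyadic_index k x \<in> Z")
      case True
      define y where "y = inv_into (ball 0 R) (dyadic_index k) (dyadic_index k x)"
      have y: "y \<in> ball 0 R" "dyadic_index k y = dyadic_index k x"
        using True inv_into_into[of "dyadic_index k x" "dyadic_index k" "ball 0 R"]
          f_inv_into_f[of "dyadic_index k x" "dyadic_index k" "ball 0 R"]
        unfolding Z_def y_def by auto
      have d: "dist y x \<le> ?d / 2 ^ k" using y(2) by (rule dist_same_dyadic_index)
      have "norm x \<le> norm y + dist y x" using norm_triangle_sub[of x y] by (simp add: dist_norm norm_minus_commute)
      then have "x \<in> cball 0 (R + ?d)" using y(1) d kd by simp
      moreover have "y \<in> cball 0 (R + ?d)" using y(1) by simp
      ultimately have "dist (\<phi> y) (\<phi> x) < \<eta>" using d k by (intro \<delta>(2)) auto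
      then show ?thesis unfolding s using True by (simp add: c_def y_def[symmetric] dist_real_def abs_minus_commute)
    next
      case False
      then have "x \<notin> ball 0 R" unfolding Z_def by blast
      then have "\<bar>\<phi> x\<bar> < \<eta>" using R by simp
      then show ?thesis unfolding s using False by simp
    qed
  qed
qed

lemma integral_near_step_sum:
  fixes \<nu> :: "(real ^ 'n::finite) measure"
  assumes fin: "finite_measure \<nu>" and sets: "sets \<nu> = sets borel"
    and \<phi>: "\<phi> \<in> borel_measurable borel" and Z: "finite Z"
    and near: "\<And>x. \<bar>\<phi> x - (\<Sum>z\<in>Z. c z * indicator (dyadic_index k -` {z}) x)\<bar> \<le> \<eta>"
  shows "\<bar>integral\<^sup>L \<nu> \<phi> - (\<Sum>z\<in>Z. c z * measure \<nu> (dyadic_index k -` {z}))\<bar> \<le> \<eta> * measure \<nu> UNIV"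
proof -
  interpret finite_measure \<nu> by (rule fin)
  have sp: "space \<nu> = UNIV" using sets_eq_imp_space_eq[OF sets] by simp
  let ?s = "\<lambda>x. \<Sum>z\<in>Z. c z * indicator (dyadic_index k -` {z}) x :: real"
  have cube: "dyadic_index k -` {z} \<in> sets \<nu>" for z using sets by simp
  have ind: "integrable \<nu> (\<lambda>x. c z * indicator (dyadic_index k -` {z}) x)" for z
    using cube by (intro integrable_mult_right integrable_real_indicator) (auto simp: less_top[symmetric])
  have s: "integrable \<nu> ?s" using ind by (intro Bochner_Integration.integrable_sum)
  have s_int: "integral\<^sup>L \<nu> ?s = (\<Sum>z\<in>Z. c z * measure \<nu> (dyadic_index k -` {z}))"
    using ind by (subst Bochner_Integration.integral_sum) (auto simp: sp)
  have \<phi>m: "\<phi> \<in> borel_measurable \<nu>" using \<phi> measurable_cong_sets[OF sets refl] by blast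
  have "integrable \<nu> (\<lambda>x. \<phi> x - ?s x)"
    using near \<phi>m s by (intro integrable_const_bound[of _ \<eta>]) auto
  then have "integrable \<nu> (\<lambda>x. (\<phi> x - ?s x) + ?s x)" using s by (rule Bochner_Integration.integrable_add)
  then have \<phi>_int: "integrable \<nu> \<phi>" by simp
  have "\<bar>integral\<^sup>L \<nu> \<phi> - integral\<^sup>L \<nu> ?s\<bar> = \<bar>\<integral>x. \<phi> x - ?s x \<partial>\<nu>\<bar>"
    using \<phi>_int s by (subst Bochner_Integration.integral_diff) auto
  also have "\<dots> \<le> (\<integral>x. \<bar>\<phi> x - ?s x\<bar> \<partial>\<nu>)" by (rule integral_abs_bound)
  also have "\<dots> \<le> (\<integral>x. \<eta> \<partial>\<nu>)"
    using near \<phi>_int s by (intro integral_mono) auto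
  also have "\<dots> = \<eta> * measure \<nu> UNIV" by (simp add: sp mult.commute)
  finally show ?thesis unfolding s_int .
qed

lemma weak_star_convergent_if_dyadic:
  fixes \<nu>s :: "nat \<Rightarrow> (real ^ 'n::finite) measure" and \<nu> :: "(real ^ 'n) measure"
  assumes fin: "\<And>n. finite_measure (\<nu>s n)" "finite_measure \<nu>"
    and sets: "\<And>n. sets (\<nu>s n) = sets borel" "sets \<nu> = sets borel"
    and mass: "\<And>n. measure (\<nu>s n) UNIV \<le> K" "measure \<nu> UNIV \<le> K"
    and conv: "\<And>A. A \<in> dyadic_sets \<Longrightarrow> (\<lambda>n. measure (\<nu>s n) A) \<longlonglongrightarrow> measure \<nu> A"
  shows "weak_star_convergent \<nu>s \<nu> sequentially"
  unfolding weak_star_convergent_def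
proof (intro allI impI, elim conjE)
  fix \<phi> :: "real ^ 'n \<Rightarrow> real"
  assume \<phi>: "continuous_on UNIV \<phi>" "(\<phi> \<longlongrightarrow> 0) at_infinity"
  have \<phi>m: "\<phi> \<in> borel_measurable borel" using \<phi>(1) by (rule borel_measurable_continuous_onI)
  have K: "K \<ge> 0" using mass(2) measure_nonneg[of \<nu> UNIV] by linarith
  show "(\<lambda>n. integral\<^sup>L (\<nu>s n) \<phi>) \<longlonglongrightarrow> integral\<^sup>L \<nu> \<phi>"
  proof (rule tendstoI)
    fix e :: real assume "e > 0"
    define \<eta> where "\<eta> = e / (3 * (K + 1))"
    have \<eta>: "\<eta> > 0" "\<eta> * K < e / 3" using \<open>e > 0\<close> K unfolding \<eta>_def by (auto simp: field_simps)
    obtain k c Z where Z: "finite Z"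
      and near: "\<And>x. \<bar>\<phi> x - (\<Sum>z\<in>Z. c z * indicator (dyadic_index k -` {z}) x)\<bar> \<le> \<eta>"
      by (rule dyadic_step_approx[OF \<phi> \<eta>(1)]) (rule that)
    let ?S = "\<lambda>\<nu>. \<Sum>z\<in>Z. c z * measure \<nu> (dyadic_index k -` {z})"
    have close: "\<bar>integral\<^sup>L \<nu>' \<phi> - ?S \<nu>'\<bar> < e / 3"
      if "finite_measure \<nu>'" "sets \<nu>' = sets borel" "measure \<nu>' UNIV \<le> K" for \<nu>' :: "(real ^ 'n) measure"
    proof -
      have "\<bar>integral\<^sup>L \<nu>' \<phi> - ?S \<nu>'\<bar> \<le> \<eta> * measure \<nu>' UNIV"
        using integral_near_step_sum[OF that(1,2) \<phi>m Z near] .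
      also have "\<dots> \<le> \<eta> * K" using that(3) \<eta>(1) by (intro mult_left_mono) auto
      finally show ?thesis using \<eta>(2) by linarith
    qed
    have "(\<lambda>n. ?S (\<nu>s n)) \<longlonglongrightarrow> ?S \<nu>"
      by (intro tendsto_sum tendsto_mult tendsto_const conv dyadic_setsI) auto
    then have "\<forall>\<^sub>F n in sequentially. dist (?S (\<nu>s n)) (?S \<nu>) < e / 3"
      using \<open>e > 0\<close> by (intro tendstoD) auto
    then show "\<forall>\<^sub>F n in sequentially. dist (integral\<^sup>L (\<nu>s n) \<phi>) (integral\<^sup>L \<nu> \<phi>) < e"
    proof (rule eventually_mono)
      fix n assume "dist (?S (\<nu>s n)) (?S \<nu>) < e / 3"
      then show "dist (integral\<^sup>L (\<nu>s n) \<phi>) (integral\<^sup>L \<nu> \<phi>) < e"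
        using close[OF fin(1) sets(1) mass(1), of n] close[OF fin(2) sets(2) mass(2)]
        unfolding dist_real_def by linarith
    qed
  qed
qed

text \<open>The excess \<open>\<delta> n\<close> stands for the boundary layer that lets a cube hold slightly more than its volume
  before passing to the limit. Tightness keeps the total mass from escaping to infinity.\<close>

theorem tight_compactness_density_le_1:
  fixes \<nu>s :: "nat \<Rightarrow> (real ^ 'n::finite) measure"
  assumes sets: "\<And>n. sets (\<nu>s n) = sets borel" and fin: "\<And>n. finite_measure (\<nu>s n)"
    and mass: "\<And>n. measure (\<nu>s n) UNIV \<le> K"
    and tight: "\<And>\<delta>. \<delta> > 0 \<Longrightarrow> \<exists>R. \<forall>n. measure (\<nu>s n) (- ball 0 R) \<le> \<delta>"
    and \<delta>: "\<delta> \<longlonglongrightarrow> 0"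
    and cubes: "\<And>n k z. measure (\<nu>s n) (dyadic_index k -` {z}) \<le> (1 / 2 ^ k + \<delta> n) ^ CARD('n)"
  obtains r :: "nat \<Rightarrow> nat" and \<rho> :: "real ^ 'n \<Rightarrow> real" where "strict_mono r"
    "integrable lborel \<rho>" "\<And>x. \<rho> x \<in> {0..1}"
    "tightly_convergent (\<lambda>n. \<nu>s (r n)) (density lborel (\<lambda>x. ennreal (\<rho> x))) sequentially"
proof -
  interpret ring_of_sets UNIV "dyadic_sets :: (real ^ 'n) set set" by (rule ring_of_sets_dyadic)
  have sp: "space (\<nu>s n) = UNIV" for n using sets_eq_imp_space_eq[OF sets] by simp
  have dyb: "A \<in> sets borel" if "A \<in> dyadic_sets" for A :: "(real ^ 'n) set"
    using that dyadic_sets_borel by blast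
  have le_mass: "measure (\<nu>s n) A \<le> K" for n A
    using finite_measure.bounded_measure[OF fin, of n A] mass[of n] sp[of n] by simp
  have K: "K \<ge> 0" using le_mass[of 0 "{}"] by simp
  have dy_ne: "(dyadic_sets :: (real ^ 'n) set set) \<noteq> {}" by blast
  let ?D = "from_nat_into (dyadic_sets :: (real ^ 'n) set set)"
  obtain r where r: "strict_mono r" "\<And>i. convergent (\<lambda>n. measure (\<nu>s (r n)) (?D i))"
    using diagonal_convergent_subseq[of "\<lambda>i n. measure (\<nu>s n) (?D i)" K] le_mass by auto
  define L where "L A = lim (\<lambda>n. measure (\<nu>s (r n)) A)" for A
  have L: "(\<lambda>n. measure (\<nu>s (r n)) A) \<longlonglongrightarrow> L A" if A: "A \<in> dyadic_sets" for A
  proof -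
    obtain i where "A = ?D i" using from_nat_into_surj[OF countable_dyadic_sets A] by metis
    then show ?thesis using r(2)[of i] unfolding L_def by (simp add: convergent_LIMSEQ_iff)
  qed
  have L_nonneg: "0 \<le> L A" if "A \<in> dyadic_sets" for A
    using L[OF that] by (rule LIMSEQ_le_const) auto
  have L_add: "L (A \<union> B) = L A + L B"
    if AB: "A \<in> dyadic_sets" "B \<in> dyadic_sets" "A \<inter> B = {}" for A B
  proof (rule LIMSEQ_unique)
    show "(\<lambda>n. measure (\<nu>s (r n)) (A \<union> B)) \<longlonglongrightarrow> L (A \<union> B)" using AB by (intro L) auto
    have "measure (\<nu>s (r n)) (A \<union> B) = measure (\<nu>s (r n)) A + measure (\<nu>s (r n)) B" for n
      using AB dyb sets by (intro finite_measure.finite_measure_Union fin) auto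
    then show "(\<lambda>n. measure (\<nu>s (r n)) (A \<union> B)) \<longlonglongrightarrow> L A + L B"
      using L[OF AB(1)] L[OF AB(2)] by (simp add: tendsto_add)
  qed
  have \<delta>r: "(\<lambda>n. \<delta> (r n)) \<longlonglongrightarrow> 0" using LIMSEQ_subseq_LIMSEQ[OF \<delta> r(1)] by (simp add: o_def)
  have L_dom: "ennreal (L A) \<le> emeasure lborel A" if A: "A \<in> dyadic_sets" for A
  proof -
    obtain k Z where Z: "A = dyadic_index k -` Z" "finite Z"
      using A by (auto simp: dyadic_sets_def)
    have A_eq: "A = (\<Union>z\<in>Z. dyadic_index k -` {z})" using Z by auto
    have disj: "disjoint_family_on (\<lambda>z. dyadic_index k -` {z} :: (real ^ 'n) set) Z"
      by (auto simp: disjoint_family_on_def)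
    have "measure (\<nu>s (r n)) A \<le> (\<Sum>z\<in>Z. (1 / 2 ^ k + \<delta> (r n)) ^ CARD('n))" for n
    proof -
      have "measure (\<nu>s (r n)) A \<le> (\<Sum>z\<in>Z. measure (\<nu>s (r n)) (dyadic_index k -` {z}))"
        unfolding A_eq using Z sets by (intro finite_measure.finite_measure_subadditive_finite fin) auto
      also have "\<dots> \<le> (\<Sum>z\<in>Z. (1 / 2 ^ k + \<delta> (r n)) ^ CARD('n))" by (intro sum_mono cubes)
      finally show ?thesis .
    qed
    moreover have "(\<lambda>n. \<Sum>z\<in>Z. (1 / 2 ^ k + \<delta> (r n)) ^ CARD('n)) \<longlonglongrightarrow> (\<Sum>z\<in>Z. (1 / 2 ^ k + 0) ^ CARD('n))"
      by (intro tendsto_intros \<delta>r)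
    ultimately have "L A \<le> (\<Sum>z\<in>Z. (1 / 2 ^ k + 0) ^ CARD('n))"
      using L[OF A] by (elim LIMSEQ_le) auto
    then have "ennreal (L A) \<le> ennreal (\<Sum>z\<in>Z. (1 / 2 ^ k) ^ CARD('n))" by (intro ennreal_leI) simp
    also have "\<dots> = (\<Sum>z\<in>Z. emeasure lborel (dyadic_index k -` {z} :: (real ^ 'n) set))"
      by (simp only: emeasure_dyadic_cube sum_ennreal zero_le_power zero_le_divide_1_iff zero_le_numeral)
    also have "\<dots> = emeasure lborel A"
      unfolding A_eq using disj Z by (intro sum_emeasure) auto
    finally show ?thesis .
  qed
  obtain \<nu> where \<nu>: "sets \<nu> = sets borel" "\<And>A. A \<in> dyadic_sets \<Longrightarrow> emeasure \<nu> A = ennreal (L A)"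
    using dominated_dyadic_content_extends[OF L_nonneg L_add L_dom] by blast
  have \<nu>L: "measure \<nu> A = L A" if "A \<in> dyadic_sets" for A
    using \<nu>(2)[OF that] L_nonneg[OF that] by (simp add: measure_def)
  have \<nu>sp: "space \<nu> = UNIV" using sets_eq_imp_space_eq[OF \<nu>(1)] by simp
  \<comment> \<open>Bounds for the limit on open sets come from their dyadic subsets, on which the limit is \<open>L\<close>.\<close>
  have \<nu>_open: "emeasure \<nu> U \<le> ennreal b"
    if U: "open U" and b: "\<And>A. A \<in> dyadic_sets \<Longrightarrow> A \<subseteq> U \<Longrightarrow> L A \<le> b" for U b
  proof -
    obtain A :: "nat \<Rightarrow> (real ^ 'n) set" where A: "range A \<subseteq> dyadic_sets" "incseq A" "(\<Union>j. A j) = U"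
      using open_eq_incseq_dyadic_sets[OF U] .
    have "(\<lambda>j. emeasure \<nu> (A j)) \<longlonglongrightarrow> emeasure \<nu> (\<Union>j. A j)"
      using A \<nu>(1) dyadic_sets_borel by (intro Lim_emeasure_incseq) auto
    then show ?thesis unfolding A(3)
    proof (rule LIMSEQ_le_const2, intro exI allI impI)
      fix j
      have "A j \<in> dyadic_sets" "A j \<subseteq> U" using A by auto
      then show "emeasure \<nu> (A j) \<le> ennreal b" using b by (simp add: \<nu>(2) ennreal_leI)
    qed
  qed
  have "emeasure \<nu> UNIV \<le> ennreal K"
    by (rule \<nu>_open) (auto intro: LIMSEQ_le_const2[OF L] le_mass)
  then have \<nu>K: "emeasure \<nu> UNIV < \<infinity>" "measure \<nu> UNIV \<le> K"
    using K by (auto simp: measure_def intro: le_less_trans enn2real_leI)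
  have fin\<nu>: "finite_measure \<nu>" by (rule finite_measureI) (use \<nu>K(1) \<nu>sp in auto)
  have conv: "(\<lambda>n. measure (\<nu>s (r n)) A) \<longlonglongrightarrow> measure \<nu> A" if "A \<in> dyadic_sets" for A
    using L[OF that] \<nu>L[OF that] by simp
  have weak: "weak_star_convergent (\<lambda>n. \<nu>s (r n)) \<nu> sequentially"
    using fin fin\<nu> sets \<nu>(1) mass \<nu>K(2) conv by (rule weak_star_convergent_if_dyadic)
  \<comment> \<open>By tightness, both the sequence and its limit put little mass outside a fixed dyadic set \<open>A\<close>, on
    which the masses converge.\<close>
  have masses: "(\<lambda>n. measure (\<nu>s (r n)) UNIV) \<longlonglongrightarrow> measure \<nu> UNIV"
  proof (rule tendstoI)
    fix e :: real assume "e > 0"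
    then obtain R where R: "\<And>n. measure (\<nu>s n) (- ball 0 R) \<le> e / 4"
      using tight[of "e / 4"] by auto
    obtain A where A: "A \<in> dyadic_sets" "ball (0 :: real ^ 'n) (R + 1) \<subseteq> A"
      by (rule ball_subset_dyadic_set)
    have "cball 0 R \<subseteq> ball (0 :: real ^ 'n) (R + 1)" by auto
    then have A_cball: "cball 0 R \<subseteq> A" using A(2) by (rule order_trans)
    have split: "measure \<nu>' UNIV = measure \<nu>' A + measure \<nu>' (- A)"
      if "finite_measure \<nu>'" "sets \<nu>' = sets borel" for \<nu>' :: "(real ^ 'n) measure"
      using finite_measure.finite_measure_Union[OF that(1), of A "- A"] dyb[OF A(1)] that(2) by simp
    have out: "measure (\<nu>s n) B \<le> e / 4" if "B \<subseteq> - cball 0 R" for n B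
    proof -
      have "measure (\<nu>s n) B \<le> measure (\<nu>s n) (- ball 0 R)"
        using that sets by (intro finite_measure.finite_measure_mono fin) auto
      with R[of n] show ?thesis by linarith
    qed
    have "emeasure \<nu> (- cball 0 R) \<le> ennreal (e / 4)"
    proof (rule \<nu>_open)
      fix B :: "(real ^ 'n) set" assume B: "B \<in> dyadic_sets" "B \<subseteq> - cball 0 R"
      show "L B \<le> e / 4" by (rule LIMSEQ_le_const2[OF L[OF B(1)]]) (use out[OF B(2)] in blast)
    qed auto
    then have "measure \<nu> (- cball 0 R) \<le> e / 4"
      using \<open>e > 0\<close> unfolding measure_def by (intro enn2real_leI) auto
    moreover have "measure \<nu> (- A) \<le> measure \<nu> (- cball 0 R)"
      using A_cball \<nu>(1) by (intro finite_measure.finite_measure_mono fin\<nu>) auto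
    ultimately have \<nu>out: "measure \<nu> (- A) \<le> e / 4" by linarith
    have "\<forall>\<^sub>F n in sequentially. dist (measure (\<nu>s (r n)) A) (measure \<nu> A) < e / 4"
      using conv[OF A(1)] \<open>e > 0\<close> by (intro tendstoD) auto
    then show "\<forall>\<^sub>F n in sequentially. dist (measure (\<nu>s (r n)) UNIV) (measure \<nu> UNIV) < e"
    proof (rule eventually_mono)
      fix n assume "dist (measure (\<nu>s (r n)) A) (measure \<nu> A) < e / 4"
      moreover have "measure (\<nu>s (r n)) (- A) \<le> e / 4" using A_cball by (intro out) auto
      moreover have "0 \<le> measure (\<nu>s (r n)) (- A)" "0 \<le> measure \<nu> (- A)" by simp_all
      ultimately show "dist (measure (\<nu>s (r n)) UNIV) (measure \<nu> UNIV) < e"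
        unfolding split[OF fin sets] split[OF fin\<nu> \<nu>(1)] dist_real_def
        using \<nu>out \<open>e > 0\<close> by linarith
    qed
  qed
  have "emeasure \<nu> B \<le> emeasure lborel B" if "B \<in> sets borel" for B
    using \<nu>(1) _ that by (rule emeasure_le_lborel_if_le_on_dyadic) (simp add: \<nu>(2) L_dom)
  then obtain \<rho> :: "real ^ 'n \<Rightarrow> real" where \<rho>: "integrable lborel \<rho>" "\<And>x. \<rho> x \<in> {0..1}"
    "\<nu> = density lborel (\<lambda>x. ennreal (\<rho> x))"
    using dominated_measure_has_density_le_1[OF \<nu>(1) fin\<nu>] by metis
  show ?thesis
    using that[OF r(1) \<rho>(1,2)] weak masses unfolding tightly_convergent_def \<rho>(3) by blast
qed

section \<open>Coercivity of the energy\<close>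

definition separated :: "real \<Rightarrow> (real ^ 'n::finite) set \<Rightarrow> bool" where
  "separated \<epsilon> X \<longleftrightarrow> (\<forall>x\<in>X. \<forall>y\<in>X. x \<noteq> y \<longrightarrow> 2 * \<epsilon> \<le> dist x y)"

lemma separated_subset: "separated \<epsilon> X \<Longrightarrow> Y \<subseteq> X \<Longrightarrow> separated \<epsilon> Y"
  unfolding separated_def by blast

text \<open>The weight of a sphere of radius \<open>1\<close>.\<close>

definition unit_sphere_weight :: "'n::finite itself \<Rightarrow> real" where
  "unit_sphere_weight _ = unit_ball_measure TYPE('n) / packing_density TYPE('n)"

lemma unit_sphere_weight_pos: "unit_sphere_weight TYPE('n::finite) > 0"
  unfolding unit_sphere_weight_def using unit_ball_measure_pos packing_density_pos by (rule divide_pos_pos)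

lemma sphere_weight_eq: "sphere_weight TYPE('n::finite) \<epsilon> = unit_sphere_weight TYPE('n) * \<epsilon> ^ CARD('n)"
  unfolding sphere_weight_def unit_sphere_weight_def by simp

lemma sphere_weight_pos: "\<epsilon> > 0 \<Longrightarrow> sphere_weight TYPE('n::finite) \<epsilon> > 0"
  by (simp add: sphere_weight_eq unit_sphere_weight_pos)

text \<open>For \<open>\<epsilon> > 0\<close> the atoms of an empirical measure are distinct, so everything may be computed from the
  finite set of atoms instead of an enumeration.\<close>

lemma empirical_measure_atoms:
  fixes \<mu> :: "(real ^ 'n::finite) measure"
  assumes "\<epsilon> > 0" "\<mu> \<in> empirical_measures \<epsilon>"
  obtains X where "finite X" "separated \<epsilon> X"
    "\<And>f :: real ^ 'n \<Rightarrow> real. f \<in> borel_measurable borel \<Longrightarrow> integral\<^sup>L \<mu> f = sum f X"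
    "\<And>A. A \<in> sets borel \<Longrightarrow> measure \<mu> A = real (card (X \<inter> A))"
    "\<And>\<sigma>. riesz_energy \<sigma> \<epsilon> \<mu> = ereal (- (sphere_weight TYPE('n) \<epsilon>)\<^sup>2 *
        (\<Sum>y\<in>X. \<Sum>z\<in>X - {y}. 1 / dist y z powr (real CARD('n) + \<sigma>)))"
proof -
  obtain N x where \<mu>: "\<mu> = dirac_sum N x" and hs: "hard_spheres \<epsilon> N x"
    using assms(2) unfolding empirical_measures_def by blast
  define X where "X = x ` {..<N}"
  have inj: "inj_on x {..<N}"
    using assms(1) hs unfolding hard_spheres_def inj_on_def by force
  have int: "integral\<^sup>L \<mu> f = sum f X" if "f \<in> borel_measurable borel" for f :: "real ^ 'n \<Rightarrow> real"
  proof -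
    have "integral\<^sup>L \<mu> f = (\<integral>i. f (x i) \<partial>count_space {..<N})"
      unfolding \<mu> dirac_sum_def using that by (intro integral_distr) auto
    also have "\<dots> = (\<Sum>i<N. f (x i))" by (simp add: lebesgue_integral_count_space_finite)
    also have "\<dots> = sum f X" unfolding X_def by (simp add: sum.reindex[OF inj])
    finally show ?thesis .
  qed
  have sp: "space \<mu> = UNIV" unfolding \<mu> dirac_sum_def by simp
  have meas: "measure \<mu> A = real (card (X \<inter> A))" if A: "A \<in> sets borel" for A
  proof -
    have "measure \<mu> A = integral\<^sup>L \<mu> (indicator A)" by (simp add: sp)
    also have "\<dots> = (\<Sum>y\<in>X. indicator A y)" using A by (intro int) auto
    also have "\<dots> = real (card (X \<inter> A))" by (simp add: X_def indicator_def sum.If_cases)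
    finally show ?thesis .
  qed
  have energy: "riesz_energy \<sigma> \<epsilon> \<mu> = ereal (- (sphere_weight TYPE('n) \<epsilon>)\<^sup>2 *
      (\<Sum>y\<in>X. \<Sum>z\<in>X - {y}. 1 / dist y z powr (real CARD('n) + \<sigma>)))" for \<sigma>
  proof -
    let ?w = "sphere_weight TYPE('n) \<epsilon>" and ?k = "\<lambda>y z. 1 / dist y z powr (real CARD('n) + \<sigma>)"
    have "pair_energy \<sigma> \<epsilon> N x = (\<Sum>(i, j)\<in>(SIGMA i:{..<N}. {..<N} - {i}). - ?k (x i) (x j) * ?w\<^sup>2)"
      unfolding pair_energy_def by (intro sum.cong) auto
    also have "\<dots> = (\<Sum>i<N. \<Sum>j\<in>{..<N} - {i}. - ?k (x i) (x j) * ?w\<^sup>2)"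
      by (subst sum.Sigma) auto
    also have "\<dots> = (\<Sum>i<N. \<Sum>z\<in>X - {x i}. - ?k (x i) z * ?w\<^sup>2)"
    proof (intro sum.cong refl)
      fix i assume i: "i \<in> {..<N}"
      have "X - {x i} = x ` ({..<N} - {i})"
        using inj i unfolding X_def by (subst inj_on_image_set_diff[OF inj]) auto
      moreover have "inj_on x ({..<N} - {i})" using inj by (rule inj_on_subset) auto
      ultimately show "(\<Sum>j\<in>{..<N} - {i}. - ?k (x i) (x j) * ?w\<^sup>2) = (\<Sum>z\<in>X - {x i}. - ?k (x i) z * ?w\<^sup>2)"
        by (simp add: sum.reindex)
    qed
    also have "\<dots> = (\<Sum>y\<in>X. \<Sum>z\<in>X - {y}. - ?k y z * ?w\<^sup>2)"
      by (subst (2) X_def) (simp add: sum.reindex[OF inj])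
    also have "\<dots> = - ?w\<^sup>2 * (\<Sum>y\<in>X. \<Sum>z\<in>X - {y}. ?k y z)"
      by (simp add: sum_distrib_left sum_negf mult.commute)
    finally show ?thesis unfolding \<mu> riesz_energy_dirac_sum[OF assms(1) hs] by simp
  qed
  have sep: "separated \<epsilon> X"
    using hs unfolding X_def separated_def hard_spheres_def by auto
  show ?thesis by (rule that[OF _ sep int meas energy]) (auto simp: X_def)
qed

lemma card_separated_Int_ball:
  fixes X :: "(real ^ 'n::finite) set"
  assumes "finite X" "separated \<epsilon> X" "0 < \<epsilon>" "\<epsilon> \<le> R"
  shows "\<epsilon> ^ CARD('n) * real (card (X \<inter> ball c R)) \<le> 2 ^ CARD('n) * R ^ CARD('n)"
proof -
  have "real (card (X \<inter> ball c R)) \<le> (R / \<epsilon> + 1) ^ CARD('n)"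
    using assms by (intro card_separated_subset_ball) (auto simp: separated_def)
  also have "\<dots> \<le> (2 * R / \<epsilon>) ^ CARD('n)"
    using assms by (intro power_mono) (auto simp: field_simps)
  also have "\<dots> = 2 ^ CARD('n) * R ^ CARD('n) / \<epsilon> ^ CARD('n)"
    by (simp add: power_divide power_mult_distrib)
  finally show ?thesis using assms by (simp add: field_simps)
qed

text \<open>The dyadic shells of outer radii \<open>R\<close>, \<open>R / 2\<close>, \<open>R / 4\<close>, \<open>\<dots>\<close> contribute a geometric series of ratio
  \<open>2 powr (p - d)\<close> to the potential: the numerator here bounds the contribution of the outermost shell, up to the
  factor \<open>R powr (d - p)\<close>.\<close>

definition riesz_shell_const :: "nat \<Rightarrow> real \<Rightarrow> real" where
  "riesz_shell_const d p = 2 ^ d * 2 powr p / (1 - 2 powr (p - real d))"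

text \<open>Each shell between \<open>R / 2\<close> and \<open>R\<close> has at most \<open>(2 R / \<epsilon>)^d\<close> points, each contributing at most
  \<open>(2 / R) powr p\<close>. Halving \<open>R\<close> ends once \<open>R \<le> 2 \<epsilon>\<close>, because no other point is that close to \<open>x\<close>.\<close>

lemma near_riesz_potential_le:
  fixes X :: "(real ^ 'n::finite) set"
  assumes X: "finite X" "separated \<epsilon> X" "x \<in> X" and \<epsilon>: "\<epsilon> > 0"
    and p: "0 < p" "p < real CARD('n)" and R: "R > 0"
  shows "\<epsilon> ^ CARD('n) * (\<Sum>y\<in>X \<inter> ball x R - {x}. 1 / dist x y powr p)
    \<le> riesz_shell_const CARD('n) p * R powr (real CARD('n) - p)"
proof -
  let ?d = "CARD('n)"
  let ?K = "riesz_shell_const ?d p"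
  let ?q = "real ?d - p"
  let ?S = "\<lambda>R. \<Sum>y\<in>X \<inter> ball x R - {x}. 1 / dist x y powr p"
  have half: "2 powr (p - real ?d) < 1" using p by (simp add: powr_less_one)
  then have "?K * (1 - 2 powr (p - real ?d)) = 2 ^ ?d * 2 powr p"
    using p(2) unfolding riesz_shell_const_def by simp
  then have K: "?K * 2 powr (p - real ?d) + 2 ^ ?d * 2 powr p = ?K" "?K \<ge> 0"
    using half p(2) by (simp_all only: right_diff_distrib) (auto simp: riesz_shell_const_def)
  have small: "?S R = 0" if "R \<le> 2 * \<epsilon>" for R
  proof -
    have "X \<inter> ball x R - {x} = {}" using X that by (fastforce simp: separated_def)
    then show ?thesis by (simp only: sum.empty)
  qed
  have main: "R < 2 ^ n * \<epsilon> \<Longrightarrow> \<epsilon> ^ ?d * ?S R \<le> ?K * R powr ?q" if "R > 0" for n :: nat and R :: real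
    using that
  proof (induction n arbitrary: R)
    case 0
    then show ?case using small[of R] K(2) by simp
  next
    case (Suc n)
    show ?case
    proof (cases "R \<le> 2 * \<epsilon>")
      case True
      then show ?thesis using small[of R] K(2) by simp
    next
      case False
      let ?shell = "X \<inter> ball x R - ball x (R / 2)"
      have split: "X \<inter> ball x R - {x} = (X \<inter> ball x (R / 2) - {x}) \<union> ?shell"
        using Suc.prems by auto
      have "?S R = ?S (R / 2) + (\<Sum>y\<in>?shell. 1 / dist x y powr p)"
        unfolding split using X(1) by (intro sum.union_disjoint) auto
      also have "(\<Sum>y\<in>?shell. 1 / dist x y powr p) \<le> (\<Sum>y\<in>?shell. (2 / R) powr p)"
      proof (intro sum_mono)
        fix y assume "y \<in> ?shell"
        then have "R / 2 \<le> dist x y" by simp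
        then have "(R / 2) powr p \<le> dist x y powr p" using p Suc.prems by (intro powr_mono2) auto
        then have "1 / dist x y powr p \<le> 1 / (R / 2) powr p"
          using Suc.prems by (intro divide_left_mono mult_pos_pos) auto
        also have "\<dots> = (2 / R) powr p" using Suc.prems by (simp add: powr_divide)
        finally show "1 / dist x y powr p \<le> (2 / R) powr p" .
      qed
      also have "\<dots> \<le> real (card (X \<inter> ball x R)) * (2 / R) powr p"
      proof -
        have "card ?shell \<le> card (X \<inter> ball x R)" using X(1) by (intro card_mono) auto
        then have "real (card ?shell) * (2 / R) powr p \<le> real (card (X \<inter> ball x R)) * (2 / R) powr p"
          by (intro mult_right_mono) auto
        then show ?thesis by simp
      qed
      finally have "\<epsilon> ^ ?d * ?S R
          \<le> \<epsilon> ^ ?d * (?S (R / 2) + real (card (X \<inter> ball x R)) * (2 / R) powr p)"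
        using \<epsilon> by (intro mult_left_mono) auto
      also have "\<dots> = \<epsilon> ^ ?d * ?S (R / 2) + \<epsilon> ^ ?d * real (card (X \<inter> ball x R)) * (2 / R) powr p"
        by (simp only: distrib_left mult.assoc)
      also have "\<epsilon> ^ ?d * ?S (R / 2) \<le> ?K * (R / 2) powr ?q"
        using Suc.prems by (intro Suc.IH) auto
      also have "\<epsilon> ^ ?d * real (card (X \<inter> ball x R)) * (2 / R) powr p
          \<le> 2 ^ ?d * R ^ ?d * (2 / R) powr p"
        using False \<epsilon> X by (intro mult_right_mono card_separated_Int_ball) auto
      also have "2 ^ ?d * R ^ ?d * (2 / R) powr p = 2 ^ ?d * 2 powr p * R powr ?q"
        using Suc.prems by (simp add: powr_divide powr_diff powr_realpow)
      also have "(R / 2) powr ?q = 2 powr (p - real ?d) * R powr ?q"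
        using Suc.prems by (simp add: powr_divide powr_diff)
      also have "?K * (2 powr (p - real ?d) * R powr ?q) + 2 ^ ?d * 2 powr p * R powr ?q
          = (?K * 2 powr (p - real ?d) + 2 ^ ?d * 2 powr p) * R powr ?q"
        by (simp add: algebra_simps)
      finally show ?thesis unfolding K(1) by simp
    qed
  qed
  obtain n where "R / \<epsilon> < 2 ^ n" using real_arch_pow[of 2 "R / \<epsilon>"] by auto
  then have "R < 2 ^ n * \<epsilon>" using \<epsilon> by (simp add: field_simps)
  with main R show ?thesis by blast
qed

text \<open>Split the potential at each atom at distance \<open>R\<close>: near atoms are controlled by separation, far ones by
  the total mass.\<close>

lemma riesz_interaction_le:
  fixes X :: "(real ^ 'n::finite) set"
  assumes X: "finite X" "separated \<epsilon> X" and \<epsilon>: "\<epsilon> > 0"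
    and p: "0 < p" "p < real CARD('n)" and R: "R > 0"
  defines "w \<equiv> sphere_weight TYPE('n) \<epsilon>"
  shows "w\<^sup>2 * (\<Sum>y\<in>X. \<Sum>z\<in>X - {y}. 1 / dist y z powr p)
    \<le> (w * real (card X)) * (unit_sphere_weight TYPE('n) * riesz_shell_const CARD('n) p *
          R powr (real CARD('n) - p) + (w * real (card X)) / R powr p)"
proof -
  let ?d = "CARD('n)" and ?c = "unit_sphere_weight TYPE('n)"
  let ?P = "?c * riesz_shell_const ?d p * R powr (real ?d - p) + (w * real (card X)) / R powr p"
  have w: "w > 0" unfolding w_def using \<epsilon> by (rule sphere_weight_pos)
  have pot: "w * (\<Sum>z\<in>X - {y}. 1 / dist y z powr p) \<le> ?P" if y: "y \<in> X" for y
  proof -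
    have split: "X - {y} = (X \<inter> ball y R - {y}) \<union> (X - ball y R)" using R by auto
    have "(\<Sum>z\<in>X - {y}. 1 / dist y z powr p) = (\<Sum>z\<in>X \<inter> ball y R - {y}. 1 / dist y z powr p)
        + (\<Sum>z\<in>X - ball y R. 1 / dist y z powr p)"
      unfolding split using X(1) by (intro sum.union_disjoint) auto
    also have "(\<Sum>z\<in>X - ball y R. 1 / dist y z powr p) \<le> (\<Sum>z\<in>X - ball y R. 1 / R powr p)"
    proof (intro sum_mono)
      fix z assume "z \<in> X - ball y R"
      then have "R powr p \<le> dist y z powr p" using p R by (intro powr_mono2) auto
      then show "1 / dist y z powr p \<le> 1 / R powr p"
        using R by (intro divide_left_mono mult_pos_pos) auto
    qed
    also have "\<dots> \<le> real (card X) / R powr p"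
      using X(1) R by (simp add: card_mono divide_right_mono)
    finally have "w * (\<Sum>z\<in>X - {y}. 1 / dist y z powr p)
        \<le> w * ((\<Sum>z\<in>X \<inter> ball y R - {y}. 1 / dist y z powr p) + real (card X) / R powr p)"
      using w by (intro mult_left_mono) auto
    also have "\<dots> = w * (\<Sum>z\<in>X \<inter> ball y R - {y}. 1 / dist y z powr p) + w * (real (card X) / R powr p)"
      by (rule distrib_left)
    also have "w * (\<Sum>z\<in>X \<inter> ball y R - {y}. 1 / dist y z powr p)
        \<le> ?c * (riesz_shell_const ?d p * R powr (real ?d - p))"
      using near_riesz_potential_le[OF X y \<epsilon> p R] unit_sphere_weight_pos[where 'n='n]
      unfolding w_def sphere_weight_eq mult.assoc by (intro mult_left_mono) auto
    finally show ?thesis by (simp add: mult.assoc)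
  qed
  have "w\<^sup>2 * (\<Sum>y\<in>X. \<Sum>z\<in>X - {y}. 1 / dist y z powr p)
      = w * (\<Sum>y\<in>X. w * (\<Sum>z\<in>X - {y}. 1 / dist y z powr p))"
    by (simp add: power2_eq_square sum_distrib_left mult.assoc)
  also have "\<dots> \<le> w * (\<Sum>y\<in>X. ?P)" using w by (intro mult_left_mono sum_mono pot) auto
  also have "\<dots> = (w * real (card X)) * ?P" by simp
  finally show ?thesis .
qed

text \<open>A ball of radius \<open>R\<close> can hold only so much mass; the rest has norm at least \<open>R\<close>.\<close>

lemma confinement_ge:
  fixes X :: "(real ^ 'n::finite) set"
  assumes X: "finite X" "separated \<epsilon> X" and \<epsilon>: "\<epsilon> > 0" "\<epsilon> \<le> R" and q: "q > 0"
  defines "w \<equiv> sphere_weight TYPE('n) \<epsilon>"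
  shows "R powr q * (w * real (card X) - 2 ^ CARD('n) * unit_sphere_weight TYPE('n) * R ^ CARD('n))
    \<le> w * (\<Sum>y\<in>X. norm y powr q)"
proof -
  let ?d = "CARD('n)" and ?c = "unit_sphere_weight TYPE('n)"
  have w: "w > 0" unfolding w_def using \<epsilon>(1) by (rule sphere_weight_pos)
  have "w * real (card (X \<inter> ball 0 R)) = ?c * (\<epsilon> ^ ?d * real (card (X \<inter> ball 0 R)))"
    by (simp add: w_def sphere_weight_eq)
  also have "\<dots> \<le> ?c * (2 ^ ?d * R ^ ?d)"
    using X \<epsilon> unit_sphere_weight_pos[where 'n='n] by (intro mult_left_mono card_separated_Int_ball) auto
  finally have inner: "w * real (card (X \<inter> ball 0 R)) \<le> 2 ^ ?d * ?c * R ^ ?d" by (simp add: mult_ac)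
  have "card X = card (X \<inter> ball 0 R) + card (X - ball 0 R)"
    using X(1) by (rule card_Int_Diff)
  then have "w * real (card X) - 2 ^ ?d * ?c * R ^ ?d \<le> w * real (card (X - ball 0 R))"
    using inner by (simp add: distrib_left)
  then have "R powr q * (w * real (card X) - 2 ^ ?d * ?c * R ^ ?d)
      \<le> R powr q * (w * real (card (X - ball 0 R)))"
    by (intro mult_left_mono) auto
  also have "\<dots> = w * (\<Sum>y\<in>X - ball 0 R. R powr q)" by simp
  also have "\<dots> \<le> w * (\<Sum>y\<in>X - ball 0 R. norm y powr q)"
    using w \<epsilon> q by (intro mult_left_mono sum_mono powr_mono2) auto
  also have "\<dots> \<le> w * (\<Sum>y\<in>X. norm y powr q)"
    using w X(1) by (intro mult_left_mono sum_mono2) auto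
  finally show ?thesis .
qed

text \<open>With \<open>A\<close> and \<open>B\<close> the coefficients of \<open>R powr (d - p)\<close> in the bound for the weighted near potential and
  of \<open>R^d\<close> in that for the mass of a ball, this is \<open>2 (A + 2 B)\<close>.\<close>

definition confinement_threshold :: "'n::finite itself \<Rightarrow> real \<Rightarrow> real" where
  "confinement_threshold _ p = 2 * unit_sphere_weight TYPE('n) *
     (riesz_shell_const CARD('n) p + 2 * 2 ^ CARD('n))"

lemma riesz_shell_const_nonneg: "p < real d \<Longrightarrow> 0 \<le> riesz_shell_const d p"
  unfolding riesz_shell_const_def by (simp add: powr_less_one less_imp_le)

text \<open>For large mass \<open>m\<close> choose \<open>R\<close> with \<open>2 B R^d = m\<close>, so that half of the mass must sit outside the ball of
  radius \<open>R\<close> and near and far parts of the potential have the same order. This requires \<open>R \<ge> \<epsilon>\<close>; if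
  \<open>R \<le> 1\<close>, the mass is at most \<open>2 B\<close> and the interaction is simply bounded by a constant.\<close>

lemma riesz_interaction_le_confinement:
  fixes p :: real
  assumes p: "0 < p" "p < real CARD('n::finite)"
  obtains D where "\<And>\<epsilon> (X :: (real ^ 'n) set). finite X \<Longrightarrow> separated \<epsilon> X \<Longrightarrow> 0 < \<epsilon> \<Longrightarrow> \<epsilon> < 1 \<Longrightarrow>
    (sphere_weight TYPE('n) \<epsilon>)\<^sup>2 * (\<Sum>y\<in>X. \<Sum>z\<in>X - {y}. 1 / dist y z powr p)
      \<le> confinement_threshold TYPE('n) p *
          (sphere_weight TYPE('n) \<epsilon> * (\<Sum>y\<in>X. norm y powr (real CARD('n) - p))) + D"
proof -
  let ?d = "CARD('n)" and ?c = "unit_sphere_weight TYPE('n)"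
  define A where "A = ?c * riesz_shell_const ?d p"
  define B where "B = 2 ^ ?d * ?c"
  have c: "?c > 0" by (rule unit_sphere_weight_pos)
  have A: "A \<ge> 0" unfolding A_def using c riesz_shell_const_nonneg[OF p(2)] by simp
  have B: "B > 0" unfolding B_def using c by simp
  have thr: "confinement_threshold TYPE('n) p = 2 * (A + 2 * B)"
    by (simp add: confinement_threshold_def A_def B_def algebra_simps)
  define D where "D = 2 * B * (A + 2 * B)"
  show ?thesis
  proof (rule that[of D])
    fix \<epsilon> :: real and X :: "(real ^ 'n) set"
    assume X: "finite X" "separated \<epsilon> X" and \<epsilon>: "0 < \<epsilon>" "\<epsilon> < 1"
    let ?q = "real ?d - p"
    define w where "w = sphere_weight TYPE('n) \<epsilon>"
    define m where "m = w * real (card X)"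
    define h where "h = w * (\<Sum>y\<in>X. norm y powr ?q)"
    define E where "E = w\<^sup>2 * (\<Sum>y\<in>X. \<Sum>z\<in>X - {y}. 1 / dist y z powr p)"
    have w: "w > 0" unfolding w_def using \<epsilon>(1) by (rule sphere_weight_pos)
    have m: "m \<ge> 0" unfolding m_def using w by simp
    have h: "h \<ge> 0" unfolding h_def using w by (intro mult_nonneg_nonneg sum_nonneg) auto
    have E: "E \<le> m * (A * R powr ?q + m / R powr p)" if "R > 0" for R
      unfolding E_def m_def A_def w_def using riesz_interaction_le[OF X \<epsilon>(1) p that] .
    have conf: "R powr ?q * (m - B * R ^ ?d) \<le> h" if "R \<ge> 1" for R
      using confinement_ge[OF X \<epsilon>(1), of R ?q] \<epsilon> p that
      unfolding m_def h_def B_def w_def by simp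
    have "E \<le> 2 * (A + 2 * B) * h + D"
    proof (cases "m \<le> 2 * B")
      case True
      have "E \<le> m * (A + m)" using E[of 1] by simp
      also have "\<dots> \<le> D" unfolding D_def using True m A B by (intro mult_mono) auto
      also have "\<dots> \<le> 2 * (A + 2 * B) * h + D" using A B h by simp
      finally show ?thesis .
    next
      case False
      define R where "R = root ?d (m / (2 * B))"
      have ratio: "m / (2 * B) > 1" using False B by simp
      have R: "R \<ge> 1" unfolding R_def using ratio by simp
      have "R ^ ?d = m / (2 * B)" unfolding R_def using ratio by (intro real_root_pow_pos2) auto
      then have mR: "m = 2 * B * R ^ ?d" using B by simp
      have "m / R powr p = 2 * B * R powr ?q"
        unfolding mR using R by (simp add: powr_diff powr_realpow)
      then have "E \<le> m * (A * R powr ?q + 2 * B * R powr ?q)" using E[of R] R by simp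
      also have "\<dots> = 2 * (A + 2 * B) * (R powr ?q * (m - B * R ^ ?d))"
        unfolding mR by (simp add: algebra_simps)
      also have "\<dots> \<le> 2 * (A + 2 * B) * h" using conf[OF R] A B by (intro mult_left_mono) auto
      also have "\<dots> \<le> 2 * (A + 2 * B) * h + D" unfolding D_def using A B by simp
      finally show ?thesis .
    qed
    then show "(sphere_weight TYPE('n) \<epsilon>)\<^sup>2 * (\<Sum>y\<in>X. \<Sum>z\<in>X - {y}. 1 / dist y z powr p)
      \<le> confinement_threshold TYPE('n) p *
          (sphere_weight TYPE('n) \<epsilon> * (\<Sum>y\<in>X. norm y powr ?q)) + D"
      unfolding E_def h_def w_def thr .
  qed
qed

text \<open>Rescale by \<open>1 / \<epsilon>\<close> to a packing in a cube of side \<open>s / \<epsilon>\<close>.\<close>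

lemma sphere_mass_in_cube_le:
  fixes X :: "(real ^ 'n::finite) set"
  assumes X: "finite X" "separated \<epsilon> X" and \<epsilon>: "\<epsilon> > 0" and s: "s \<ge> 0"
    and sub: "\<And>x i. x \<in> X \<Longrightarrow> a $ i \<le> x $ i \<and> x $ i \<le> a $ i + s"
  shows "sphere_weight TYPE('n) \<epsilon> * real (card X) \<le> (s + 2 * \<epsilon>) ^ CARD('n)"
proof -
  let ?d = "CARD('n)" and ?C = "packing_density TYPE('n)" and ?\<omega> = "unit_ball_measure TYPE('n)"
  define Y where "Y = (\<lambda>x. x /\<^sub>R \<epsilon>) ` X"
  have inj: "inj_on (\<lambda>x. x /\<^sub>R \<epsilon>) X" using \<epsilon> by (auto simp: inj_on_def)
  have "Y \<in> packings"
    unfolding packings_def Y_def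
  proof safe
    fix x y assume xy: "x \<in> X" "y \<in> X" "x /\<^sub>R \<epsilon> \<noteq> y /\<^sub>R \<epsilon>"
    then have "2 * \<epsilon> \<le> dist x y" using X(2) by (auto simp: separated_def)
    moreover have "dist (x /\<^sub>R \<epsilon>) (y /\<^sub>R \<epsilon>) = dist x y / \<epsilon>"
      using \<epsilon> by (simp add: dist_norm scaleR_diff_right[symmetric] divide_inverse_commute del: scaleR_diff_right)
    moreover have "2 \<le> dist x y / \<epsilon>" if "2 * \<epsilon> \<le> dist x y"
      using that \<epsilon> by (simp add: field_simps)
    ultimately show "2 \<le> dist (x /\<^sub>R \<epsilon>) (y /\<^sub>R \<epsilon>)" by metis
  qed
  then have "real (card Y) * ?\<omega> \<le> ?C * (s / \<epsilon> + 2) ^ ?d"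
  proof (rule card_packing_in_cube_le[where a = "a /\<^sub>R \<epsilon>"])
    fix x i assume "x \<in> Y"
    then obtain y where "y \<in> X" "x = y /\<^sub>R \<epsilon>" by (auto simp: Y_def)
    then show "(a /\<^sub>R \<epsilon>) $ i \<le> x $ i \<and> x $ i \<le> (a /\<^sub>R \<epsilon>) $ i + s / \<epsilon>"
      using sub[of y i] \<epsilon> by (simp add: field_simps)
  qed (use X s \<epsilon> in \<open>auto simp: Y_def\<close>)
  then have "real (card X) * ?\<omega> \<le> ?C * (s / \<epsilon> + 2) ^ ?d"
    unfolding Y_def card_image[OF inj] .
  then have "real (card X) * ?\<omega> / ?C \<le> (s / \<epsilon> + 2) ^ ?d"
    using packing_density_pos[where 'n='n] by (simp add: field_simps)
  then have "\<epsilon> ^ ?d * (real (card X) * ?\<omega> / ?C) \<le> \<epsilon> ^ ?d * (s / \<epsilon> + 2) ^ ?d"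
    using \<epsilon> by (intro mult_left_mono) auto
  also have "\<epsilon> ^ ?d * (s / \<epsilon> + 2) ^ ?d = (s + 2 * \<epsilon>) ^ ?d"
    using \<epsilon> by (simp add: power_mult_distrib[symmetric] distrib_left mult.commute)
  finally show ?thesis by (simp add: sphere_weight_def mult_ac)
qed

lemma confinement_threshold_pos:
  assumes "p < real CARD('n::finite)"
  shows "confinement_threshold TYPE('n) p > 0"
  unfolding confinement_threshold_def
  using unit_sphere_weight_pos[where 'n='n] riesz_shell_const_nonneg[OF assms]
  by (intro mult_pos_pos add_nonneg_pos) auto

lemma empirical_if_total_energy_le:
  assumes "total_energy \<sigma> g \<epsilon> \<mu> \<le> ereal M"
  shows "\<mu> \<in> empirical_measures \<epsilon>"
proof (rule ccontr)
  assume "\<mu> \<notin> empirical_measures \<epsilon>"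
  then show False using assms by (simp add: total_energy_def riesz_energy_def)
qed

text \<open>With \<open>\<kappa> = C2 - T > 0\<close>, \<open>T\<close> the threshold, the energy dominates \<open>\<kappa> h + C1 m\<close> up to a constant. As
  \<open>h\<close> grows faster than linearly in \<open>m\<close>, this bounds the mass \<open>m\<close> even for negative \<open>C1\<close>, and then \<open>h\<close>.
  The last bound is Markov's inequality for \<open>h\<close>.\<close>

lemma energy_a_priori_bounds:
  fixes g :: "real ^ 'n::finite \<Rightarrow> real"
  assumes \<sigma>: "- real CARD('n) < \<sigma>" "\<sigma> < 0"
    and g: "continuous_on UNIV g" "\<And>x. C1 + C2 * norm x powr (- \<sigma>) \<le> g x"
    and C2: "confinement_threshold TYPE('n) (real CARD('n) + \<sigma>) < C2"
  obtains K H where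
    "\<And>\<epsilon> \<mu>. 0 < \<epsilon> \<Longrightarrow> \<epsilon> < 1 \<Longrightarrow> total_energy \<sigma> g \<epsilon> \<mu> \<le> ereal M \<Longrightarrow>
       sphere_weight TYPE('n) \<epsilon> * measure \<mu> UNIV \<le> K"
    "\<And>\<epsilon> \<mu> R. 0 < \<epsilon> \<Longrightarrow> \<epsilon> < 1 \<Longrightarrow> total_energy \<sigma> g \<epsilon> \<mu> \<le> ereal M \<Longrightarrow> 0 < R \<Longrightarrow>
       sphere_weight TYPE('n) \<epsilon> * measure \<mu> (- ball 0 R) \<le> H / R powr (- \<sigma>)"
proof -
  let ?d = "CARD('n)" and ?c = "unit_sphere_weight TYPE('n)"
  let ?p = "real ?d + \<sigma>" and ?q = "- \<sigma>"
  define T where "T = confinement_threshold TYPE('n) ?p"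
  have p: "0 < ?p" "?p < real ?d" using \<sigma> by auto
  obtain D where D: "\<And>\<epsilon> (X :: (real ^ 'n) set). finite X \<Longrightarrow> separated \<epsilon> X \<Longrightarrow> 0 < \<epsilon> \<Longrightarrow> \<epsilon> < 1 \<Longrightarrow>
    (sphere_weight TYPE('n) \<epsilon>)\<^sup>2 * (\<Sum>y\<in>X. \<Sum>z\<in>X - {y}. 1 / dist y z powr ?p)
      \<le> T * (sphere_weight TYPE('n) \<epsilon> * (\<Sum>y\<in>X. norm y powr (real ?d - ?p))) + D"
    unfolding T_def by (rule riesz_interaction_le_confinement[OF p]) blast
  define \<kappa> where "\<kappa> = C2 - T"
  have \<kappa>: "\<kappa> > 0" using C2 by (simp add: \<kappa>_def T_def)
  \<comment> \<open>At the radius \<open>S\<close> the surplus confinement \<open>\<kappa> * S powr q\<close> outweighs \<open>\<bar>C1\<bar>\<close>; the mass inside is at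
    most \<open>b\<close>.\<close>
  define S where "S = max 1 (((\<bar>C1\<bar> + 1) / \<kappa>) powr (1 / ?q))"
  have S: "S \<ge> 1" by (simp add: S_def)
  have \<kappa>S: "\<bar>C1\<bar> + 1 \<le> \<kappa> * S powr ?q"
  proof -
    have "(\<bar>C1\<bar> + 1) / \<kappa> = (((\<bar>C1\<bar> + 1) / \<kappa>) powr (1 / ?q)) powr ?q"
      using \<sigma> \<kappa> by (simp add: powr_powr)
    also have "\<dots> \<le> S powr ?q" using \<sigma> by (intro powr_mono2) (auto simp: S_def)
    finally show ?thesis using \<kappa> by (simp add: field_simps)
  qed
  define b where "b = 2 ^ ?d * ?c * S ^ ?d"
  define K where "K = max b (M + D + (\<bar>C1\<bar> + 1) * b)"
  define H where "H = (M + D + \<bar>C1\<bar> * K) / \<kappa>"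
  have main: "sphere_weight TYPE('n) \<epsilon> * measure \<mu> UNIV \<le> K \<and>
      (\<forall>R>0. sphere_weight TYPE('n) \<epsilon> * measure \<mu> (- ball 0 R) \<le> H / R powr ?q)"
    if \<epsilon>: "0 < \<epsilon>" "\<epsilon> < 1" and tot: "total_energy \<sigma> g \<epsilon> \<mu> \<le> ereal M" for \<epsilon> \<mu>
  proof -
    obtain X where X: "finite X" "separated \<epsilon> X"
      and int: "\<And>f :: real ^ 'n \<Rightarrow> real. f \<in> borel_measurable borel \<Longrightarrow> integral\<^sup>L \<mu> f = sum f X"
      and meas: "\<And>A. A \<in> sets borel \<Longrightarrow> measure \<mu> A = real (card (X \<inter> A))"
      and energy: "\<And>\<sigma>. riesz_energy \<sigma> \<epsilon> \<mu> = ereal (- (sphere_weight TYPE('n) \<epsilon>)\<^sup>2 *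
        (\<Sum>y\<in>X. \<Sum>z\<in>X - {y}. 1 / dist y z powr (real ?d + \<sigma>)))"
      by (rule empirical_measure_atoms[OF \<epsilon>(1) empirical_if_total_energy_le[OF tot]]) blast
    define w where "w = sphere_weight TYPE('n) \<epsilon>"
    define m where "m = w * real (card X)"
    define h where "h = w * (\<Sum>y\<in>X. norm y powr ?q)"
    define E where "E = w\<^sup>2 * (\<Sum>y\<in>X. \<Sum>z\<in>X - {y}. 1 / dist y z powr ?p)"
    have w: "w > 0" unfolding w_def using \<epsilon>(1) by (rule sphere_weight_pos)
    have h: "h \<ge> 0" unfolding h_def using w by (intro mult_nonneg_nonneg sum_nonneg) auto
    have "g \<in> borel_measurable borel" using g(1) by (rule borel_measurable_continuous_onI)
    then have "(\<integral>x. g x * w \<partial>\<mu>) = (\<Sum>y\<in>X. g y * w)" by (intro int) auto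
    then have "total_energy \<sigma> g \<epsilon> \<mu> = ereal (- E + (\<Sum>y\<in>X. g y * w))"
      unfolding total_energy_def energy by (simp add: E_def w_def)
    with tot have "- E + (\<Sum>y\<in>X. g y * w) \<le> M" by simp
    moreover have "E \<le> T * h + D"
      using D[OF X \<epsilon>] unfolding E_def h_def w_def by simp
    moreover have "C1 * m + C2 * h \<le> (\<Sum>y\<in>X. g y * w)"
    proof -
      have "C1 * m + C2 * h = (\<Sum>y\<in>X. (C1 + C2 * norm y powr ?q) * w)"
        unfolding m_def h_def
        by (simp add: sum.distrib sum_distrib_left algebra_simps)
      also have "\<dots> \<le> (\<Sum>y\<in>X. g y * w)" using g(2) w by (intro sum_mono mult_right_mono) auto
      finally show ?thesis .
    qed
    ultimately have key: "\<kappa> * h + C1 * m \<le> M + D"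
      unfolding \<kappa>_def left_diff_distrib by linarith
    have m: "m \<ge> 0" unfolding m_def using w by simp
    have mK: "m \<le> K"
    proof (cases "m \<le> b")
      case True
      then show ?thesis by (simp add: K_def)
    next
      case False
      have "S powr ?q * (m - b) \<le> h"
        using confinement_ge[OF X \<epsilon>(1), of S ?q] S \<epsilon> \<sigma> unfolding m_def h_def b_def w_def by simp
      then have "\<kappa> * (S powr ?q * (m - b)) \<le> \<kappa> * h" using \<kappa> by (intro mult_left_mono) auto
      moreover have "(\<bar>C1\<bar> + 1) * (m - b) \<le> (\<kappa> * S powr ?q) * (m - b)"
        using \<kappa>S False by (intro mult_right_mono) auto
      ultimately have "(\<bar>C1\<bar> + 1) * (m - b) + C1 * m \<le> M + D" using key by (simp add: mult.assoc)
      moreover have "- \<bar>C1\<bar> * m \<le> C1 * m" using m by (intro mult_right_mono) auto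
      ultimately have "m \<le> M + D + (\<bar>C1\<bar> + 1) * b" by (simp add: algebra_simps)
      then show ?thesis by (simp add: K_def)
    qed
    have "- (\<bar>C1\<bar> * K) \<le> C1 * m"
    proof -
      have "\<bar>C1\<bar> * m \<le> \<bar>C1\<bar> * K" using mK by (intro mult_left_mono) auto
      moreover have "- \<bar>C1\<bar> * m \<le> C1 * m" using m by (intro mult_right_mono) auto
      ultimately show ?thesis by simp
    qed
    with key have "\<kappa> * h \<le> M + D + \<bar>C1\<bar> * K" by linarith
    then have hH: "h \<le> H" unfolding H_def using \<kappa> by (simp add: field_simps)
    have "w * measure \<mu> (- ball 0 R) \<le> H / R powr ?q" if R: "R > 0" for R
    proof -
      have "R powr ?q * (w * measure \<mu> (- ball 0 R)) = w * (\<Sum>y\<in>X - ball 0 R. R powr ?q)"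
        by (subst meas) (auto simp: Diff_eq)
      also have "\<dots> \<le> w * (\<Sum>y\<in>X - ball 0 R. norm y powr ?q)"
        using w R \<sigma> by (intro mult_left_mono sum_mono powr_mono2) auto
      also have "\<dots> \<le> h"
        unfolding h_def using w X(1) by (intro mult_left_mono sum_mono2) auto
      also have "\<dots> \<le> H" by (rule hH)
      finally show ?thesis using R by (simp add: field_simps)
    qed
    moreover have "measure \<mu> UNIV = real (card X)" by (subst meas) auto
    ultimately show ?thesis using mK unfolding m_def w_def by simp
  qed
  show ?thesis by (rule that[of K H]) (use main in blast)+
qed

lemma empirical_mass_in_dyadic_cube_le:
  fixes \<mu> :: "(real ^ 'n::finite) measure"
  assumes "\<epsilon> > 0" "\<mu> \<in> empirical_measures \<epsilon>"
  shows "sphere_weight TYPE('n) \<epsilon> * measure \<mu> (dyadic_index k -` {z}) \<le> (1 / 2 ^ k + 2 * \<epsilon>) ^ CARD('n)"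
proof -
  obtain X where X: "finite X" "separated \<epsilon> X"
    and meas: "\<And>A. A \<in> sets borel \<Longrightarrow> measure \<mu> A = real (card (X \<inter> A))"
    by (rule empirical_measure_atoms[OF assms, where thesis=thesis]) blast
  let ?Q = "dyadic_index k -` {z} :: (real ^ 'n) set"
  have "sphere_weight TYPE('n) \<epsilon> * real (card (X \<inter> ?Q)) \<le> (1 / 2 ^ k + 2 * \<epsilon>) ^ CARD('n)"
  proof (rule sphere_mass_in_cube_le[where a = "\<chi> i. of_int (z $ i) / 2 ^ k"])
    show "separated \<epsilon> (X \<inter> ?Q)" using X(2) by (rule separated_subset) auto
    fix x i assume "x \<in> X \<inter> ?Q"
    then show "(\<chi> i. of_int (z $ i) / 2 ^ k) $ i \<le> x $ i \<and>
        x $ i \<le> (\<chi> i. of_int (z $ i) / 2 ^ k) $ i + 1 / 2 ^ k"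
      unfolding dyadic_cube_eq by (auto intro: less_imp_le)
  qed (use X assms in auto)
  then show ?thesis by (subst meas) auto
qed

theorem theorem3p1:
  fixes \<sigma> :: real
  assumes "- real CARD('n::finite) < \<sigma>" and "\<sigma> < 0"
  shows "\<exists>Cstar > 0. \<forall>g :: real ^ 'n \<Rightarrow> real.
    continuous_on UNIV g \<longrightarrow>
    (\<exists>C1 C2. C2 > Cstar \<and> (\<forall>x. g x \<ge> C1 + C2 * norm x powr (- \<sigma>))) \<longrightarrow>
    (\<forall>M > 0. \<forall>\<mu> :: real \<Rightarrow> (real ^ 'n) measure.
       (\<forall>\<epsilon>\<in>{0<..<1}. \<mu> \<epsilon> \<in> finite_radon_measures \<and> total_energy \<sigma> g \<epsilon> (\<mu> \<epsilon>) \<le> ereal M) \<longrightarrow>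
       (\<exists>(e :: nat \<Rightarrow> real) (\<rho> :: real ^ 'n \<Rightarrow> real).
          (\<forall>n. e n \<in> {0<..<1}) \<and> e \<longlonglongrightarrow> 0 \<and>
          integrable lborel \<rho> \<and> (\<forall>x. \<rho> x \<in> {0..1}) \<and>
          tightly_convergent
            (\<lambda>n. scale_measure (ennreal (sphere_weight TYPE('n) (e n))) (\<mu> (e n)))
            (density lborel (\<lambda>x. ennreal (\<rho> x))) sequentially))"
proof (rule exI[of _ "confinement_threshold TYPE('n) (real CARD('n) + \<sigma>)"], intro conjI allI impI)
  let ?d = "CARD('n)"
  let ?Cstar = "confinement_threshold TYPE('n) (real ?d + \<sigma>)"
  show "?Cstar > 0" using assms by (intro confinement_threshold_pos) simp
  fix g :: "real ^ 'n \<Rightarrow> real" and M :: real and \<mu> :: "real \<Rightarrow> (real ^ 'n) measure"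
  assume g: "continuous_on UNIV g"
    and "\<exists>C1 C2. C2 > ?Cstar \<and> (\<forall>x. g x \<ge> C1 + C2 * norm x powr (- \<sigma>))"
    and \<mu>: "\<forall>\<epsilon>\<in>{0<..<1}. \<mu> \<epsilon> \<in> finite_radon_measures \<and> total_energy \<sigma> g \<epsilon> (\<mu> \<epsilon>) \<le> ereal M"
  then obtain C1 C2 where C: "?Cstar < C2" "\<And>x. C1 + C2 * norm x powr (- \<sigma>) \<le> g x" by blast
  obtain K H where K: "\<And>\<epsilon> \<mu>. 0 < \<epsilon> \<Longrightarrow> \<epsilon> < 1 \<Longrightarrow> total_energy \<sigma> g \<epsilon> \<mu> \<le> ereal M \<Longrightarrow>
       sphere_weight TYPE('n) \<epsilon> * measure \<mu> UNIV \<le> K"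
    and H: "\<And>\<epsilon> \<mu> R. 0 < \<epsilon> \<Longrightarrow> \<epsilon> < 1 \<Longrightarrow> total_energy \<sigma> g \<epsilon> \<mu> \<le> ereal M \<Longrightarrow> 0 < R \<Longrightarrow>
       sphere_weight TYPE('n) \<epsilon> * measure \<mu> (- ball 0 R) \<le> H / R powr (- \<sigma>)"
    by (rule energy_a_priori_bounds[OF assms g C(2,1)]) blast
  define e where "e n = 1 / (real n + 2)" for n
  have e: "0 < e n" "e n < 1" for n by (auto simp: e_def)
  have e_lim: "e \<longlonglongrightarrow> 0"
    using LIMSEQ_ignore_initial_segment[OF LIMSEQ_inverse_real_of_nat, of 1]
    by (simp add: e_def[abs_def] inverse_eq_divide add.commute)
  define \<nu>s where "\<nu>s n = scale_measure (ennreal (sphere_weight TYPE('n) (e n))) (\<mu> (e n))" for n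
  have w: "sphere_weight TYPE('n) (e n) > 0" for n using e(1) by (rule sphere_weight_pos)
  have radon: "sets (\<mu> (e n)) = sets borel" "finite_measure (\<mu> (e n))"
    and en: "total_energy \<sigma> g (e n) (\<mu> (e n)) \<le> ereal M" for n
    using \<mu> e[of n] by (auto simp: finite_radon_measures_def)
  have emp: "\<mu> (e n) \<in> empirical_measures (e n)" for n
    using en by (rule empirical_if_total_energy_le)
  have meas: "measure (\<nu>s n) A = sphere_weight TYPE('n) (e n) * measure (\<mu> (e n)) A" for n A
    unfolding \<nu>s_def using w[of n] by (simp add: measure_scale_measure measure_def enn2real_mult)
  have sets: "sets (\<nu>s n) = sets borel" for n by (simp add: \<nu>s_def radon)
  have fin: "finite_measure (\<nu>s n)" for n
    using finite_measure.emeasure_finite[OF radon(2)[of n]]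
    by (intro finite_measureI) (simp add: \<nu>s_def ennreal_mult_eq_top_iff)
  have tight: "\<exists>R. \<forall>n. measure (\<nu>s n) (- ball 0 R) \<le> \<delta>" if \<delta>: "\<delta> > 0" for \<delta>
  proof -
    \<comment> \<open>Chosen so that \<open>R powr (- \<sigma>) = (\<bar>H\<bar> + 1) / \<delta>\<close>.\<close>
    define R where "R = ((\<bar>H\<bar> + 1) / \<delta>) powr (1 / - \<sigma>)"
    have R: "R > 0" using \<delta> by (simp add: R_def)
    have "R powr (- \<sigma>) = (\<bar>H\<bar> + 1) / \<delta>" using \<delta> assms by (simp add: R_def powr_powr)
    then have "H / R powr (- \<sigma>) = H / ((\<bar>H\<bar> + 1) / \<delta>)" by simp
    also have "\<dots> = \<delta> * (H / (\<bar>H\<bar> + 1))" using \<delta> by simp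
    also have "\<dots> \<le> \<delta> * 1" using \<delta> by (intro mult_left_mono) auto
    finally have "measure (\<nu>s n) (- ball 0 R) \<le> \<delta>" for n
      using H[OF e en R, of n] unfolding meas by linarith
    then show ?thesis by blast
  qed
  have mass: "measure (\<nu>s n) UNIV \<le> K" for n unfolding meas using e en by (rule K)
  have cubes: "measure (\<nu>s n) (dyadic_index k -` {z}) \<le> (1 / 2 ^ k + 2 * e n) ^ ?d" for n k z
    unfolding meas using e(1) emp by (rule empirical_mass_in_dyadic_cube_le)
  have e2: "(\<lambda>n. 2 * e n) \<longlonglongrightarrow> 0" using tendsto_mult_right_zero[OF e_lim] by simp
  obtain r :: "nat \<Rightarrow> nat" and \<rho> :: "real ^ 'n \<Rightarrow> real" where r: "strict_mono r"
    and \<rho>: "integrable lborel \<rho>" "\<And>x. \<rho> x \<in> {0..1}"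
      "tightly_convergent (\<lambda>n. \<nu>s (r n)) (density lborel (\<lambda>x. ennreal (\<rho> x))) sequentially"
    using tight_compactness_density_le_1[OF sets fin mass tight e2 cubes] by metis
  have "(\<lambda>n. e (r n)) \<longlonglongrightarrow> 0" using LIMSEQ_subseq_LIMSEQ[OF e_lim r] by (simp add: o_def)
  then show "\<exists>(e :: nat \<Rightarrow> real) (\<rho> :: real ^ 'n \<Rightarrow> real).
      (\<forall>n. e n \<in> {0<..<1}) \<and> e \<longlonglongrightarrow> 0 \<and>
      integrable lborel \<rho> \<and> (\<forall>x. \<rho> x \<in> {0..1}) \<and>
      tightly_convergent
        (\<lambda>n. scale_measure (ennreal (sphere_weight TYPE('n) (e n))) (\<mu> (e n)))
        (density lborel (\<lambda>x. ennreal (\<rho> x))) sequentially"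
    using e \<rho> unfolding \<nu>s_def by (intro exI[of _ "\<lambda>n. e (r n)"] exI[of _ \<rho>]) auto
qed

end
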